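(* The adaptivity gap of the Stochastic Boolean Function Evaluation problem on $k$-of-$n$ functions is exactly $2$. That is, let $\mathcal{I}$ be the class of all instances $(f,c,p)$ where $n\in\mathbb{N}$, $k\in\{1,\dots,n\}$, $f:\{0,1\}^n\to\{0,1\}$ is the $k$-of-$n$ function, $c\in\mathbb{R}_{\ge 0}^n$ and $p\in(0,1)^n$. Then $$\sup_{(f,c,p)\in\mathcal{I}} \frac{\mathrm{E}_p[\mathrm{cost}_c(\mathrm{OPT}_{\mathrm{NA}}(f,c,p))]}{\mathrm{E}_p[\mathrm{cost}_c(\mathrm{OPT}(f,c,p))]} = 2,$$ where the supremum is over the instances whose denominator is positive.
   Context: The $k$-of-$n$ function is $f:\{0,1\}^n\to\{0,1\}$ with $f(x)=1$ iff $x_1+\dots+x_n\ge k$. The variables $x_1,\dots,x_n$ are independent Boolean random variables with $\Pr[x_i=1]=p_i\in(0,1)$; testing $x_i$ reveals its value and costs $c_i\ge 0$. A state is a vector $s\in\{0,1,\bullet\}^n$, where $s_i$ is the known value of $x_i$ or $\bullet$ if $x_i$ is not yet tested; initially all entries are $\bullet$. A vector $x\in\{0,1\}^n$ follows from $s$ if $s_i\in\{x_i,\bullet\}$ for all $i$. The function $f$ is determined by $s$ if $f$ takes the same value on all $x\in\{0,1\}^n$ following from $s$. A policy is a function $\pi:\{0,1,\bullet\}^n\setminus\{0,1\}^n\to\{1,\dots,n\}$ with $s_{\pi(s)}=\bullet$ for every such $s$; in state $s$ the variable $x_{\pi(s)}$ is tested. Testing continues exactly until $f$ is determined by the current state. If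 $S$ is the (random) set of indices tested until then, $\mathrm{cost}_c(\pi)=\sum_{i\in S}c_i$, and $\mathrm{E}_p$ denotes expectation over $x$. A policy is non-adaptive if $\pi(s)$ depends only on the number of unknown variables in $s$; equivalently, it tests the variables in a fixed order (a permutation of $\{1,\dots,n\}$) until $f$ is determined. $\mathrm{OPT}(f,c,p)$ is a policy, and $\mathrm{OPT}_{\mathrm{NA}}(f,c,p)$ a non-adaptive policy, minimizing the expected cost among all policies and among all non-adaptive policies, respectively. *)

theory Defs
  imports "HOL-Probability.Probability" "HOL-Probability.Product_PMF"
    "HOL-Library.While_Combinator" "HOL-Combinatorics.Permutations"
begin

text \<open>
  Variables are indexed by \<open>{1..n}\<close>. A vector in \<open>{0,1}\<^sup>n\<close> is a function
  \<open>nat \<Rightarrow> bool\<close> that is \<open>False\<close> outside \<open>{1..n}\<close>, matching the default value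
  used in the product distribution below. A state is a partial map whose domain
  is the set of variables tested so far, so \<open>None\<close> stands for the symbol \<open>\<bullet>\<close>.
\<close>

type_synonym state = "nat \<Rightarrow> bool option"
type_synonym policy = "state \<Rightarrow> nat"

definition cube :: "nat \<Rightarrow> (nat \<Rightarrow> bool) set" where
  "cube n = PiE_dflt {1..n} False (\<lambda>_. UNIV)"

definition k_of_n :: "nat \<Rightarrow> nat \<Rightarrow> (nat \<Rightarrow> bool) \<Rightarrow> bool" where
  "k_of_n k n x \<longleftrightarrow> (\<Sum>i=1..n. of_bool (x i)) \<ge> k"

definition follows :: "nat \<Rightarrow> (nat \<Rightarrow> bool) \<Rightarrow> state \<Rightarrow> bool" where
  "follows n x s \<longleftrightarrow> (\<forall>i\<in>{1..n}. s i \<in> {Some (x i), None})"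

definition determined :: "nat \<Rightarrow> ((nat \<Rightarrow> bool) \<Rightarrow> bool) \<Rightarrow> state \<Rightarrow> bool" where
  "determined n f s \<longleftrightarrow>
     (\<forall>x\<in>cube n. \<forall>y\<in>cube n. follows n x s \<longrightarrow> follows n y s \<longrightarrow> f x = f y)"

text \<open>Values of a policy on maps that are not incomplete states are irrelevant.\<close>

definition is_policy :: "nat \<Rightarrow> policy \<Rightarrow> bool" where
  "is_policy n \<pi> \<longleftrightarrow> (\<forall>s. dom s \<subset> {1..n} \<longrightarrow> \<pi> s \<in> {1..n} \<and> s (\<pi> s) = None)"

text \<open>
  A non-adaptive policy tests the variables in the fixed order
  \<open>\<sigma> 1, \<dots>, \<sigma> n\<close>. The condition only concerns states that can be reached by
  testing in this order: for \<open>n \<ge> 2\<close> no policy can have \<open>\<pi> s\<close> depend only on the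
  number of unknown variables for all incomplete \<open>s\<close>, since \<open>\<pi> s\<close> has to be
  unknown in \<open>s\<close>.
\<close>

definition is_nonadaptive :: "nat \<Rightarrow> policy \<Rightarrow> bool" where
  "is_nonadaptive n \<pi> \<longleftrightarrow> is_policy n \<pi> \<and>
     (\<exists>\<sigma>. \<sigma> permutes {1..n} \<and>
        (\<forall>s j. j < n \<longrightarrow> dom s = \<sigma> ` {1..j} \<longrightarrow> \<pi> s = \<sigma> (Suc j)))"

text \<open>
  The loop terminates for every policy, as each step tests a new variable and
  \<open>f\<close> is determined once all variables are known.
\<close>

definition final_state ::
    "nat \<Rightarrow> ((nat \<Rightarrow> bool) \<Rightarrow> bool) \<Rightarrow> policy \<Rightarrow> (nat \<Rightarrow> bool) \<Rightarrow> state" where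
  "final_state n f \<pi> x =
     while (\<lambda>s. \<not> determined n f s) (\<lambda>s. s(\<pi> s \<mapsto> x (\<pi> s))) Map.empty"

definition cost ::
    "nat \<Rightarrow> ((nat \<Rightarrow> bool) \<Rightarrow> bool) \<Rightarrow> (nat \<Rightarrow> real) \<Rightarrow> policy \<Rightarrow> (nat \<Rightarrow> bool) \<Rightarrow> real" where
  "cost n f c \<pi> x = (\<Sum>i\<in>dom (final_state n f \<pi> x). c i)"

definition input_pmf :: "nat \<Rightarrow> (nat \<Rightarrow> real) \<Rightarrow> (nat \<Rightarrow> bool) pmf" where
  "input_pmf n p = Pi_pmf {1..n} False (\<lambda>i. bernoulli_pmf (p i))"

definition expected_cost ::
    "nat \<Rightarrow> ((nat \<Rightarrow> bool) \<Rightarrow> bool) \<Rightarrow> (nat \<Rightarrow> real) \<Rightarrow> (nat \<Rightarrow> real) \<Rightarrow> policy \<Rightarrow> real" where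
  "expected_cost n f c p \<pi> = measure_pmf.expectation (input_pmf n p) (cost n f c \<pi>)"

text \<open>
  Minimizers exist for \<open>n \<ge> 1\<close>: the expected cost of a policy depends only on its
  values on the finitely many incomplete states.
\<close>

definition OPT ::
    "nat \<Rightarrow> ((nat \<Rightarrow> bool) \<Rightarrow> bool) \<Rightarrow> (nat \<Rightarrow> real) \<Rightarrow> (nat \<Rightarrow> real) \<Rightarrow> policy" where
  "OPT n f c p = arg_min (expected_cost n f c p) (is_policy n)"

definition OPT_NA ::
    "nat \<Rightarrow> ((nat \<Rightarrow> bool) \<Rightarrow> bool) \<Rightarrow> (nat \<Rightarrow> real) \<Rightarrow> (nat \<Rightarrow> real) \<Rightarrow> policy" where
  "OPT_NA n f c p = arg_min (expected_cost n f c p) (is_nonadaptive n)"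

text \<open>The Boolean function is part of an instance, together with its arity \<open>n\<close>.\<close>

definition instances ::
    "(nat \<times> ((nat \<Rightarrow> bool) \<Rightarrow> bool) \<times> (nat \<Rightarrow> real) \<times> (nat \<Rightarrow> real)) set" where
  "instances = {(n, f, c, p). (\<exists>k\<in>{1..n}. f = k_of_n k n) \<and>
     (\<forall>i\<in>{1..n}. 0 \<le> c i) \<and> (\<forall>i\<in>{1..n}. 0 < p i \<and> p i < 1)}"

end

theory Submission
  imports Defs "HOL-Real_Asymp.Real_Asymp"
begin

text \<open>
  Upper bound: an input with \<open>f x = b\<close> is certified by enough variables of value \<open>b\<close>. By an
  exchange argument, restricted to these inputs no policy beats testing in increasing order of
  \<open>c i / w i\<close>, where \<open>w i\<close> is the probability that \<open>x i = b\<close>. Every policy pays at least the sum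
  of these two bounds. Merging the two orders so that both progress at equal cost gives a
  nonadaptive policy which on every input pays at most twice the order that is right for it.

  Lower bound: many free fair coins decide, almost uniformly, whether \<open>j\<close> variables that are almost
  surely 1 or \<open>j\<close> variables that are almost surely 0 have to be tested, for \<open>j = 1, \<dots>, a\<close>. An
  adaptive policy tests the \<open>j\<close> cheapest ones of the right kind. A nonadaptive one must interleave
  the two kinds, and each pair of variables costs it at least their smaller cost. With the costs
  \<open>1 / (l (l + 1))\<close> the two totals are asymptotic to \<open>2 H\<^sub>a\<close> and \<open>4 H\<^sub>a\<close>, where \<open>H\<^sub>a\<close> is the
  harmonic number.
\<close>

section \<open>Expectations over random inputs\<close>

lemma finite_cube [simp]: "finite (cube n)"
  unfolding cube_def by (intro finite_PiE_dflt) auto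

lemma set_input_pmf: "set_pmf (input_pmf n p) \<subseteq> cube n"
  unfolding input_pmf_def cube_def using set_Pi_pmf_subset'[of "{1..n}" False]
  by (auto simp: PiE_dflt_def)

lemma integrable_input [simp]: "integrable (measure_pmf (input_pmf n p)) (g :: _ \<Rightarrow> real)"
  by (rule integrable_measure_pmf_finite) (rule finite_subset[OF set_input_pmf finite_cube])

lemma input_expectation_sum:
  "measure_pmf.expectation (input_pmf n p) g = (\<Sum>x\<in>cube n. pmf (input_pmf n p) x * (g x :: real))"
  using set_input_pmf by (subst integral_measure_pmf[of "cube n"]) auto

lemma pmf_expectation_cong:
  fixes g h :: "'a \<Rightarrow> real"
  assumes "\<And>x. x \<in> set_pmf M \<Longrightarrow> g x = h x"
  shows "measure_pmf.expectation M g = measure_pmf.expectation M h"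
  using assms by (intro integral_cong_AE) (auto simp: AE_measure_pmf_iff)

lemma input_expectation_mono:
  fixes g h :: "_ \<Rightarrow> real"
  assumes "\<And>x. x \<in> set_pmf (input_pmf n p) \<Longrightarrow> g x \<le> h x"
  shows "measure_pmf.expectation (input_pmf n p) g \<le> measure_pmf.expectation (input_pmf n p) h"
  using assms by (intro integral_mono_AE) (auto simp: AE_measure_pmf_iff)

text \<open>Fixing the probability of a variable to 0 or 1 amounts to conditioning on its value.\<close>

lemma input_expectation_split:
  fixes g :: "_ \<Rightarrow> real"
  assumes j: "j \<in> {1..n}" and p: "0 \<le> p j" "p j \<le> 1"
  shows "measure_pmf.expectation (input_pmf n p) g =
     p j * measure_pmf.expectation (input_pmf n (p(j := 1))) g +
     (1 - p j) * measure_pmf.expectation (input_pmf n (p(j := 0))) g"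
proof -
  have "pmf (input_pmf n p) x =
      p j * pmf (input_pmf n (p(j := 1))) x + (1 - p j) * pmf (input_pmf n (p(j := 0))) x"
    if x: "x \<in> cube n" for x
  proof -
    have out: "\<And>i. i \<notin> {1..n} \<Longrightarrow> x i = False"
      using x by (auto simp: cube_def PiE_dflt_def)
    have eq: "pmf (input_pmf n q) x =
        pmf (bernoulli_pmf (q j)) (x j) * (\<Prod>i\<in>{1..n}-{j}. pmf (bernoulli_pmf (q i)) (x i))" for q
      unfolding input_pmf_def using j out by (subst pmf_Pi') (auto simp: prod.remove)
    have "(\<Prod>i\<in>{1..n}-{j}. pmf (bernoulli_pmf ((p(j := r)) i)) (x i)) =
        (\<Prod>i\<in>{1..n}-{j}. pmf (bernoulli_pmf (p i)) (x i))" for r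
      by (intro prod.cong) auto
    then show ?thesis
      unfolding eq using p by (cases "x j") (simp_all del: fun_upd_apply, simp_all)
  qed
  then have "(\<Sum>x\<in>cube n. pmf (input_pmf n p) x * g x) =
      (\<Sum>x\<in>cube n. (p j * pmf (input_pmf n (p(j := 1))) x +
        (1 - p j) * pmf (input_pmf n (p(j := 0))) x) * g x)"
    by (intro sum.cong) auto
  then show ?thesis
    unfolding input_expectation_sum
    by (simp add: sum_distrib_left sum.distrib distrib_right mult.assoc)
qed

section \<open>Runs of policies\<close>

text \<open>Keeping the start state as an argument permits the induction over untested variables in
  \<open>policy_cost_ge\<close>.\<close>

definition run :: "nat \<Rightarrow> ((nat \<Rightarrow> bool) \<Rightarrow> bool) \<Rightarrow> policy \<Rightarrow> state \<Rightarrow> (nat \<Rightarrow> bool) \<Rightarrow> state" where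
  "run n f \<pi> s x = while (\<lambda>s. \<not> determined n f s) (\<lambda>s. s(\<pi> s \<mapsto> x (\<pi> s))) s"

definition observed :: "(nat \<Rightarrow> bool) \<Rightarrow> nat set \<Rightarrow> state" where
  "observed x S = (\<lambda>i. if i \<in> S then Some (x i) else None)"

lemma dom_observed [simp]: "dom (observed x S) = S"
  by (auto simp: observed_def dom_def)

lemma observed_empty [simp]: "observed x {} = Map.empty"
  by (simp add: observed_def)

lemma observed_insert: "(observed x S)(i \<mapsto> x i) = observed x (insert i S)"
  by (auto simp: observed_def)

lemma observed_eq_None [simp]: "observed x S i = None \<longleftrightarrow> i \<notin> S"
  by (simp add: observed_def)

lemma observed_eq_Some [simp]: "observed x S i = Some v \<longleftrightarrow> i \<in> S \<and> x i = v"
  by (simp add: observed_def)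

lemma run_unfold:
  "run n f \<pi> s x = (if determined n f s then s else run n f \<pi> (s(\<pi> s \<mapsto> x (\<pi> s))) x)"
  unfolding run_def by (subst while_unfold) auto

lemma final_state_run: "final_state n f \<pi> x = run n f \<pi> Map.empty x"
  by (simp add: final_state_def run_def)

lemma determined_full:
  assumes "dom s = {1..n}"
  shows "determined n f s"
proof -
  have "x = y" if "x \<in> cube n" "y \<in> cube n" "follows n x s" "follows n y s" for x y
  proof
    fix i
    show "x i = y i"
    proof (cases "i \<in> {1..n}")
      case True
      then obtain v where "s i = Some v" using assms by blast
      with True that show ?thesis by (force simp: follows_def)
    next
      case False
      with that show ?thesis by (simp add: cube_def PiE_dflt_def)
    qed
  qed
  then show ?thesis by (auto simp: determined_def)
qed

lemma policyD:
  assumes "is_policy n \<pi>" "dom s \<subseteq> {1..n}" "\<not> determined n f s"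
  shows "\<pi> s \<in> {1..n}" "s (\<pi> s) = None"
  using assms determined_full[of s n f] unfolding is_policy_def by blast+

text \<open>On a fixed input \<open>x\<close> every state reached is some
  \<open>observed x S\<close>, so invariants can speak about the tested set \<open>S\<close> alone.
  Each step enlarges \<open>S\<close> inside \<open>{1..n}\<close>, which gives termination.\<close>

lemma final_state_invariant:
  assumes pol: "is_policy n \<pi>" and init: "I {}"
    and step: "\<And>S. S \<subseteq> {1..n} \<Longrightarrow> \<not> determined n f (observed x S) \<Longrightarrow> I S \<Longrightarrow>
      \<pi> (observed x S) \<in> {1..n} - S \<Longrightarrow> I (insert (\<pi> (observed x S)) S)"
  obtains S where "S \<subseteq> {1..n}" "final_state n f \<pi> x = observed x S"
    "determined n f (observed x S)" "I S"
proof -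
  define P where "P = (\<lambda>s. \<exists>S\<subseteq>{1..n}. s = observed x S \<and> I S)"
  have next_var: "\<pi> (observed x S) \<in> {1..n} - S"
    if "S \<subseteq> {1..n}" "\<not> determined n f (observed x S)" for S
    using policyD[OF pol _ that(2)] that(1) by auto
  have "P (final_state n f \<pi> x) \<and> determined n f (final_state n f \<pi> x)"
    unfolding final_state_def
  proof (rule while_rule[where P = P and r = "Wellfounded.measure (\<lambda>s. n - card (dom s))"])
    show "P Map.empty"
      unfolding P_def using init by (intro exI[of _ "{}"]) auto
  next
    fix s assume "P s" and nd: "\<not> determined n f s"
    then obtain S where S: "S \<subseteq> {1..n}" "s = observed x S" "I S" by (auto simp: P_def)
    with nd next_var have v: "\<pi> s \<in> {1..n} - S" by blast
    then show "P (s(\<pi> s \<mapsto> x (\<pi> s)))"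
      unfolding P_def using S nd step[of S]
      by (intro exI[of _ "insert (\<pi> s) S"]) (auto simp: observed_insert)
    have "card (insert (\<pi> s) S) \<le> card {1..n}"
      using v S by (intro card_mono) auto
    moreover have "card (insert (\<pi> s) S) = Suc (card S)"
      using v S finite_subset[OF S(1)] by simp
    ultimately show "(s(\<pi> s \<mapsto> x (\<pi> s)), s) \<in> Wellfounded.measure (\<lambda>s. n - card (dom s))"
      using S by (auto simp: observed_insert)
  qed auto
  then show thesis
    using that by (auto simp: P_def)
qed

lemma final_state_tested:
  assumes "is_policy n \<pi>"
  obtains S where "S \<subseteq> {1..n}" "final_state n f \<pi> x = observed x S"
    "determined n f (observed x S)"
  by (rule final_state_invariant[OF assms, where I = "\<lambda>_. True"]) auto

lemma cost_bounds:
  assumes "is_policy n \<pi>" "\<And>i. i \<in> {1..n} \<Longrightarrow> 0 \<le> c i"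
  shows "0 \<le> cost n f c \<pi> x" "cost n f c \<pi> x \<le> (\<Sum>i=1..n. c i)"
proof -
  obtain S where S: "S \<subseteq> {1..n}" "final_state n f \<pi> x = observed x S"
    using final_state_tested[OF assms(1)] by metis
  show "0 \<le> cost n f c \<pi> x"
    unfolding cost_def S(2) using S(1) assms(2) by (auto intro!: sum_nonneg)
  show "cost n f c \<pi> x \<le> (\<Sum>i=1..n. c i)"
    unfolding cost_def S(2) using S(1) assms(2) by (auto intro!: sum_mono2)
qed

lemma cost_le_of_invariant:
  assumes pol: "is_policy n \<pi>" and c: "\<And>i. i \<in> {1..n} \<Longrightarrow> 0 \<le> c i"
    and step: "\<And>S. S \<subseteq> {1..n} \<inter> V \<Longrightarrow> \<not> determined n f (observed x S) \<Longrightarrow>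
      \<pi> (observed x S) \<in> V"
  shows "cost n f c \<pi> x \<le> sum c ({1..n} \<inter> V)"
proof -
  obtain S where S: "S \<subseteq> {1..n}" "final_state n f \<pi> x = observed x S" "S \<subseteq> V"
    by (rule final_state_invariant[OF pol, where I = "\<lambda>S. S \<subseteq> V" and f = f and x = x])
       (use step in auto)
  then show ?thesis
    unfolding cost_def using c by (auto intro!: sum_mono2)
qed

lemma nonadaptive_final_state:
  assumes pol: "is_policy n \<pi>" and perm: "\<sigma> permutes {1..n}"
    and order: "\<And>s j. j < n \<Longrightarrow> dom s = \<sigma> ` {1..j} \<Longrightarrow> \<pi> s = \<sigma> (Suc j)"
  obtains m where "m \<le> n" "final_state n f \<pi> x = observed x (\<sigma> ` {1..m})"
    "determined n f (observed x (\<sigma> ` {1..m}))"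
proof -
  obtain S where "final_state n f \<pi> x = observed x S" "determined n f (observed x S)"
    "\<exists>m\<le>n. S = \<sigma> ` {1..m}"
  proof (rule final_state_invariant[OF pol, where I = "\<lambda>S. \<exists>m\<le>n. S = \<sigma> ` {1..m}" and f = f and x = x])
    show "\<exists>m\<le>n. {} = \<sigma> ` {1..m}" by (intro exI[of _ 0]) auto
    fix S assume nd: "\<not> determined n f (observed x S)" and "\<exists>m\<le>n. S = \<sigma> ` {1..m}"
    then obtain m where m: "m \<le> n" "S = \<sigma> ` {1..m}" by blast
    have "m \<noteq> n"
    proof
      assume "m = n"
      then have "S = {1..n}" using m(2) permutes_image[OF perm] by simp
      then show False using nd determined_full[of "observed x S" n f] by simp
    qed
    then have "m < n" using m(1) by simp
    then have "insert (\<pi> (observed x S)) S = \<sigma> ` {1..Suc m}"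
      using order[of m "observed x S"] m(2) by (simp add: atLeastAtMostSuc_conv)
    then show "\<exists>m\<le>n. insert (\<pi> (observed x S)) S = \<sigma> ` {1..m}"
      using \<open>m < n\<close> by (intro exI[of _ "Suc m"]) simp
  qed blast
  then show thesis using that by blast
qed

text \<open>The expected cost depends on a policy only through the map from inputs in the finite
  cube to tested sets. There are finitely many such maps, hence finitely many values, and the least
  one is attained.\<close>

lemma optimal_policy_exists:
  assumes "\<And>\<pi>. P \<pi> \<Longrightarrow> is_policy n \<pi>" "P \<pi>0"
  shows "P (arg_min (expected_cost n f c p) P)"
    "\<And>\<pi>. P \<pi> \<Longrightarrow> expected_cost n f c p (arg_min (expected_cost n f c p) P) \<le> expected_cost n f c p \<pi>"
proof -
  define G where "G = (\<lambda>D :: (nat \<Rightarrow> bool) \<Rightarrow> nat set.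
    \<Sum>x\<in>cube n. pmf (input_pmf n p) x * (\<Sum>i\<in>D x. c i))"
  have "expected_cost n f c p ` Collect P \<subseteq> G ` (PiE (cube n) (\<lambda>_. Pow {1..n}))"
  proof
    fix v assume "v \<in> expected_cost n f c p ` Collect P"
    then obtain \<pi> where \<pi>: "P \<pi>" "v = expected_cost n f c p \<pi>" by auto
    define D where "D = restrict (\<lambda>x. dom (final_state n f \<pi> x)) (cube n)"
    have "dom (final_state n f \<pi> x) \<subseteq> {1..n}" for x
      using final_state_tested[OF assms(1)[OF \<pi>(1)]] by (metis dom_observed)
    then have "D \<in> PiE (cube n) (\<lambda>_. Pow {1..n})"
      by (auto simp: D_def)
    moreover have "v = G D"
      unfolding \<pi>(2) expected_cost_def input_expectation_sum G_def
      by (intro sum.cong) (auto simp: D_def cost_def)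
    ultimately show "v \<in> G ` (PiE (cube n) (\<lambda>_. Pow {1..n}))" by blast
  qed
  moreover have "finite (G ` (PiE (cube n) (\<lambda>_. Pow {1..n})))"
    by (intro finite_imageI finite_PiE) auto
  ultimately have fin: "finite (expected_cost n f c p ` Collect P)"
    by (rule finite_subset)
  moreover have ne: "expected_cost n f c p ` Collect P \<noteq> {}" using assms(2) by auto
  ultimately have "Min (expected_cost n f c p ` Collect P) \<in> expected_cost n f c p ` Collect P"
    by (rule Min_in)
  then obtain \<pi> where "P \<pi>" "expected_cost n f c p \<pi> = Min (expected_cost n f c p ` Collect P)"
    by auto
  then have "is_arg_min (expected_cost n f c p) P \<pi>"
    unfolding is_arg_min_linorder using fin by (auto intro!: Min_le)
  then have "is_arg_min (expected_cost n f c p) P (arg_min (expected_cost n f c p) P)"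
    unfolding arg_min_def by (rule someI[where P = "is_arg_min (expected_cost n f c p) P"])
  then show "P (arg_min (expected_cost n f c p) P)"
    "\<And>\<pi>. P \<pi> \<Longrightarrow> expected_cost n f c p (arg_min (expected_cost n f c p) P) \<le> expected_cost n f c p \<pi>"
    by (auto simp: is_arg_min_linorder)
qed

text \<open>If \<open>L\<close> lists all variables, skipping the known ones gives a legal test in
  every incomplete state, also in states that testing along \<open>L\<close> never reaches.\<close>

definition order_policy :: "nat list \<Rightarrow> policy" where
  "order_policy L s = hd (filter (\<lambda>i. s i = None) L)"

lemma order_policy_mem:
  assumes "i \<in> set L" "s i = None"
  shows "order_policy L s \<in> set L" "s (order_policy L s) = None"
proof -
  have "filter (\<lambda>i. s i = None) L \<noteq> []"
    using assms by (auto simp: filter_empty_conv)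
  from hd_in_set[OF this] show "order_policy L s \<in> set L" "s (order_policy L s) = None"
    by (auto simp: order_policy_def)
qed

lemma order_policy_append:
  assumes "i \<in> set L" "s i = None"
  shows "order_policy (L @ L') s = order_policy L s"
proof -
  have "filter (\<lambda>i. s i = None) L \<noteq> []"
    using assms by (auto simp: filter_empty_conv)
  then show ?thesis by (simp add: order_policy_def)
qed

lemma order_policy_skip:
  assumes "set L \<subseteq> dom s"
  shows "order_policy (L @ L') s = order_policy L' s"
proof -
  have "filter (\<lambda>i. s i = None) L = []"
    using assms by (auto simp: filter_empty_conv)
  then show ?thesis by (simp add: order_policy_def)
qed

lemma order_policy_min:
  fixes T :: "nat \<Rightarrow> 'a::linorder"
  assumes "sorted (map T L)" "i \<in> set L" "s i = None"
  shows "T (order_policy L s) \<le> T i"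
proof -
  let ?F = "filter (\<lambda>i. s i = None) L"
  have i: "i \<in> set ?F" using assms by auto
  then obtain y ys where F: "?F = y # ys" by (cases ?F) auto
  have "sorted (map T ?F)" using assms(1) by (rule sorted_filter)
  then show ?thesis using i unfolding order_policy_def F by auto
qed

text \<open>The list may depend on the state, so this also serves the adaptive policy below.\<close>

lemma is_policy_order:
  assumes "\<And>s. \<exists>L. set L = {1..n} \<and> \<pi> s = order_policy L s"
  shows "is_policy n \<pi>"
  unfolding is_policy_def
proof (intro allI impI)
  fix s :: state assume "dom s \<subset> {1..n}"
  then obtain i where "i \<in> {1..n}" "s i = None" by blast
  moreover obtain L where "set L = {1..n}" "\<pi> s = order_policy L s" using assms by blast
  ultimately show "\<pi> s \<in> {1..n} \<and> s (\<pi> s) = None"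
    using order_policy_mem[of i L s] by simp
qed

lemma is_nonadaptive_order:
  assumes L: "distinct L" "set L = {1..n}"
  shows "is_nonadaptive n (order_policy L)"
proof -
  have len: "length L = n" using distinct_card[OF L(1)] L(2) by simp
  define \<sigma> where "\<sigma> = (\<lambda>i. if i \<in> {1..n} then L ! (i - 1) else i)"
  have img: "\<sigma> ` {1..j} = set (take j L)" if "j \<le> n" for j
  proof -
    have "\<sigma> ` {1..j} = (\<lambda>i. L ! (i - 1)) ` {1..j}"
      using that by (intro image_cong) (auto simp: \<sigma>_def)
    also have "\<dots> = (!) L ` {0..<j}"
    proof -
      have "{1..j} = Suc ` {0..<j}"
        by (metis One_nat_def atLeastLessThanSuc_atLeastAtMost image_Suc_atLeastLessThan)
      then show ?thesis unfolding image_image by (simp only: image_image diff_Suc_1)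
    qed
    also have "\<dots> = set (take j L)" using that len by (simp add: nth_image)
    finally show ?thesis .
  qed
  have "\<sigma> permutes {1..n}"
  proof (rule bij_imp_permutes)
    have "\<sigma> ` {1..n} = {1..n}" using img[of n] len L(2) by simp
    then show "bij_betw \<sigma> {1..n} {1..n}"
      by (simp add: bij_betw_def eq_card_imp_inj_on)
  qed (auto simp: \<sigma>_def)
  moreover have "order_policy L s = \<sigma> (Suc j)" if "j < n" "dom s = \<sigma> ` {1..j}" for s :: state and j
  proof -
    have d: "dom s = set (take j L)" using that img by simp
    have "filter (\<lambda>i. s i = None) (drop j L) = drop j L"
    proof (rule filter_True, rule ballI)
      fix i assume "i \<in> set (drop j L)"
      with L(1) have "i \<notin> set (take j L)"
        by (metis append_take_drop_id disjoint_iff distinct_append)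
      with d show "s i = None" by blast
    qed
    moreover have "order_policy L s = order_policy (drop j L) s"
      using order_policy_skip[of "take j L" s "drop j L"] d by simp
    ultimately have "order_policy L s = hd (drop j L)" by (simp add: order_policy_def)
    then show ?thesis using that len by (simp add: \<sigma>_def hd_drop_conv_nth)
  qed
  moreover have "is_policy n (order_policy L)"
    using L(2) by (intro is_policy_order) auto
  ultimately show ?thesis unfolding is_nonadaptive_def by blast
qed

lemma OPT_properties:
  shows "is_policy n (OPT n f c p)"
    "is_policy n \<pi> \<Longrightarrow> expected_cost n f c p (OPT n f c p) \<le> expected_cost n f c p \<pi>"
    "is_nonadaptive n (OPT_NA n f c p)"
    "is_nonadaptive n \<pi> \<Longrightarrow> expected_cost n f c p (OPT_NA n f c p) \<le> expected_cost n f c p \<pi>"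
proof -
  have na: "is_nonadaptive n (order_policy [1..<Suc n])"
    by (rule is_nonadaptive_order) auto
  then have pol: "is_policy n (order_policy [1..<Suc n])" by (simp add: is_nonadaptive_def)
  show "is_policy n (OPT n f c p)"
    "is_policy n \<pi> \<Longrightarrow> expected_cost n f c p (OPT n f c p) \<le> expected_cost n f c p \<pi>"
    unfolding OPT_def using optimal_policy_exists[of "is_policy n", OF _ pol] by blast+
  have "is_nonadaptive n \<pi> \<Longrightarrow> is_policy n \<pi>" for \<pi> by (simp add: is_nonadaptive_def)
  then show "is_nonadaptive n (OPT_NA n f c p)"
    "is_nonadaptive n \<pi> \<Longrightarrow> expected_cost n f c p (OPT_NA n f c p) \<le> expected_cost n f c p \<pi>"
    unfolding OPT_NA_def using optimal_policy_exists[of "is_nonadaptive n", OF _ na] by blast+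
qed

section \<open>Certificates for k-of-n functions\<close>

text \<open>The size of a certificate: \<open>k\<close> ones force the value 1, and
  \<open>n + 1 - k\<close> zeros leave at most \<open>k - 1\<close> ones.\<close>

definition quota :: "nat \<Rightarrow> nat \<Rightarrow> bool \<Rightarrow> nat" where
  "quota n k b = (if b then k else n + 1 - k)"

lemma k_of_n_card: "k_of_n k n x \<longleftrightarrow> k \<le> card {i \<in> {1..n}. x i}"
proof -
  have "(\<Sum>i=1..n. of_bool (x i) :: nat) = card {i \<in> {1..n}. x i}"
    by (simp add: Int_def)
  then show ?thesis by (simp add: k_of_n_def)
qed

lemma card_complement: "card {i \<in> {1..n}. x i = b} + card {i \<in> {1..n}. x i = (\<not> b)} = n"
proof -
  have "card {i \<in> {1..n}. x i = b} + card {i \<in> {1..n}. x i = (\<not> b)} =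
      card ({i \<in> {1..n}. x i = b} \<union> {i \<in> {1..n}. x i = (\<not> b)})"
    by (subst card_Un_disjoint) auto
  also have "{i \<in> {1..n}. x i = b} \<union> {i \<in> {1..n}. x i = (\<not> b)} = {1..n}" by auto
  finally show ?thesis by simp
qed

lemma k_of_n_quota:
  assumes "k \<le> n"
  shows "k_of_n k n x = b \<longleftrightarrow> quota n k b \<le> card {i \<in> {1..n}. x i = b}"
proof (cases b)
  case True
  then show ?thesis by (simp add: k_of_n_card quota_def)
next
  case False
  then show ?thesis
    using assms card_complement[of n x b] by (auto simp: k_of_n_card quota_def)
qed

lemma determined_k_of_n:
  assumes k: "k \<le> n" and s: "dom s \<subseteq> {1..n}"
  shows "determined n (k_of_n k n) s \<longleftrightarrow> (\<exists>b. quota n k b \<le> card {i. s i = Some b})"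
proof
  assume "\<exists>b. quota n k b \<le> card {i. s i = Some b}"
  then obtain b where b: "quota n k b \<le> card {i. s i = Some b}" by blast
  have "k_of_n k n x = b" if "follows n x s" for x
  proof -
    have "x i = b" if i: "s i = Some b" for i
      using \<open>follows n x s\<close> s i by (force simp: follows_def)
    then have "{i. s i = Some b} \<subseteq> {i \<in> {1..n}. x i = b}"
      using s by auto
    then have "card {i. s i = Some b} \<le> card {i \<in> {1..n}. x i = b}"
      by (intro card_mono) auto
    with b show ?thesis unfolding k_of_n_quota[OF k] by linarith
  qed
  then show "determined n (k_of_n k n) s" by (auto simp: determined_def)
next
  assume det: "determined n (k_of_n k n) s"
  define fill where "fill = (\<lambda>d i. if i \<in> {1..n} then (case s i of None \<Rightarrow> d | Some v \<Rightarrow> v) else False)"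
  have fill: "fill d \<in> cube n" "follows n (fill d) s" for d
    by (auto simp: fill_def cube_def PiE_dflt_def follows_def split: option.splits)
  define b where "b = k_of_n k n (fill True)"
  have "k_of_n k n (fill d) = b" for d
    using det fill by (auto simp: determined_def b_def)
  \<comment> \<open>Filling the unknown entries with \<open>\<not> b\<close> leaves only observed
    entries of value \<open>b\<close>, yet the function value is still \<open>b\<close>.\<close>
  then have "quota n k b \<le> card {i \<in> {1..n}. fill (\<not> b) i = b}"
    using k_of_n_quota[OF k] by blast
  also have "{i \<in> {1..n}. fill (\<not> b) i = b} = {i. s i = Some b}"
    using s by (auto simp: fill_def split: option.splits)
  finally show "\<exists>b. quota n k b \<le> card {i. s i = Some b}" by blast
qed

lemma determined_observed:
  assumes "k \<le> n" "S \<subseteq> {1..n}"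
  shows "determined n (k_of_n k n) (observed x S) \<longleftrightarrow> (\<exists>b. quota n k b \<le> card {i \<in> S. x i = b})"
  using determined_k_of_n[of k n "observed x S"] assms by (simp add: Collect_conj_eq)

section \<open>Testing in a fixed order until a quota is met\<close>

text \<open>
  Let \<open>w i\<close> be the probability that variable \<open>i\<close> has the value \<open>b\<close>. When the variables of
  \<open>L\<close> are tested in this order until \<open>m\<close> of them have shown the value \<open>b\<close>, \<open>success\<close> is the
  probability that this happens, \<open>list_cost\<close> the cost on a fixed input, and \<open>success_cost\<close> the
  expectation of the cost restricted to the event of success.
\<close>

fun success :: "(nat \<Rightarrow> real) \<Rightarrow> nat list \<Rightarrow> nat \<Rightarrow> real" where
  "success w L 0 = 1"
| "success w [] (Suc m) = 0"
| "success w (i # L) (Suc m) = w i * success w L m + (1 - w i) * success w L (Suc m)"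

fun success_cost :: "(nat \<Rightarrow> real) \<Rightarrow> (nat \<Rightarrow> real) \<Rightarrow> nat list \<Rightarrow> nat \<Rightarrow> real" where
  "success_cost c w L 0 = 0"
| "success_cost c w [] (Suc m) = 0"
| "success_cost c w (i # L) (Suc m) =
     c i * success w (i # L) (Suc m) + w i * success_cost c w L m + (1 - w i) * success_cost c w L (Suc m)"

fun list_cost :: "(nat \<Rightarrow> real) \<Rightarrow> bool \<Rightarrow> nat list \<Rightarrow> nat \<Rightarrow> (nat \<Rightarrow> bool) \<Rightarrow> real" where
  "list_cost c b L 0 x = 0"
| "list_cost c b [] (Suc m) x = 0"
| "list_cost c b (i # L) (Suc m) x = c i + list_cost c b L (if x i = b then m else Suc m) x"

lemma success_eq_0: "length L < m \<Longrightarrow> success w L m = 0"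
  by (induction w L m rule: success.induct) auto

lemma success_cost_eq_0: "length L < m \<Longrightarrow> success_cost c w L m = 0"
  by (induction c w L m rule: success_cost.induct) (auto simp: success_eq_0)

lemma success_swap: "success w (i # j # L) m = success w (j # i # L) m"
proof (cases m)
  case (Suc m')
  then show ?thesis by (cases m') (simp_all add: algebra_simps)
qed simp

text \<open>Success only asks for enough variables of value \<open>b\<close>, whatever their
  order.\<close>

lemma success_move_front: "success w (L1 @ j # L2) m = success w (j # L1 @ L2) m"
proof (induction L1 arbitrary: m)
  case (Cons i L1)
  have "success w (i # L1 @ j # L2) m = success w (i # j # L1 @ L2) m"
    by (cases m) (simp_all del: success.simps(3) add: success.simps(3)[of w i] Cons)
  then show ?case by (simp add: success_swap)
qed simp

text \<open>The two orders differ only if exactly one \<open>b\<close> is missing. Then testing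
  \<open>i\<close> first saves \<open>c j\<close> with probability \<open>w i\<close>, and testing
  \<open>j\<close> first saves \<open>c i\<close> with probability \<open>w j\<close>. A saving
  means that the quota is met, so restricting to success loses nothing, and the difference is
  \<open>c i * w j - c j * w i\<close>.\<close>

lemma success_cost_swap:
  assumes "c i * w j \<le> c j * w i"
  shows "success_cost c w (i # j # L) m \<le> success_cost c w (j # i # L) m"
proof (cases m)
  case (Suc m')
  then show ?thesis using assms by (cases m') (simp_all add: algebra_simps)
qed simp

text \<open>Adjacent swaps carry \<open>j\<close> to the front. Prepending a common variable
  preserves the inequality, as its weight lies in \<open>[0, 1]\<close> and the success probability
  ignores the order.\<close>

lemma success_cost_move_front:
  assumes "\<And>i. i \<in> set L1 \<Longrightarrow> c i * w j \<le> c j * w i"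
    and "\<And>i. i \<in> set L1 \<Longrightarrow> 0 \<le> w i \<and> w i \<le> 1"
  shows "success_cost c w (L1 @ j # L2) m \<le> success_cost c w (j # L1 @ L2) m"
  using assms
proof (induction L1 arbitrary: m)
  case (Cons i L1)
  have IH: "success_cost c w (L1 @ j # L2) m \<le> success_cost c w (j # L1 @ L2) m" for m
    using Cons by simp
  have "success_cost c w (i # L1 @ j # L2) m \<le> success_cost c w (i # j # L1 @ L2) m"
  proof (cases m)
    case (Suc m')
    have "success w (i # L1 @ j # L2) m = success w (i # j # L1 @ L2) m"
      using success_move_front[of w "i # L1" j L2 m] success_swap[of w i j "L1 @ L2" m] by simp
    moreover have "w i * success_cost c w (L1 @ j # L2) m' \<le> w i * success_cost c w (j # L1 @ L2) m'"
      "(1 - w i) * success_cost c w (L1 @ j # L2) m \<le> (1 - w i) * success_cost c w (j # L1 @ L2) m"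
      using Cons.prems(2)[of i] by (intro mult_left_mono IH; simp)+
    ultimately show ?thesis
      unfolding Suc success_cost.simps(3)[of c w i] by (intro add_mono) simp_all
  qed simp
  also have "\<dots> \<le> success_cost c w (j # i # L1 @ L2) m"
    using Cons.prems by (intro success_cost_swap) simp
  finally show ?case by simp
qed simp

text \<open>With costs read as durations, this is the time at which the test of \<open>j\<close>
  ends when testing along \<open>L\<close>.\<close>

fun finish :: "(nat \<Rightarrow> real) \<Rightarrow> nat list \<Rightarrow> nat \<Rightarrow> real" where
  "finish c [] j = 0"
| "finish c (i # L) j = c i + (if j = i then 0 else finish c L j)"

text \<open>The tests completed by time \<open>C\<close> form a prefix of \<open>L\<close>, and its
  total duration is the completion time of its last test.\<close>

lemma sum_finish_le:
  assumes "distinct L" "\<And>i. i \<in> set L \<Longrightarrow> 0 \<le> c i" "0 \<le> C"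
  shows "sum c {i \<in> set L. finish c L i \<le> C} \<le> C"
  using assms
proof (induction L arbitrary: C)
  case (Cons i L)
  have nonneg: "0 \<le> finish c L j" for j
    using Cons.prems(2) by (induction L) (auto intro!: add_nonneg_nonneg)
  show ?case
  proof (cases "c i \<le> C")
    case True
    have "{j \<in> set (i # L). finish c (i # L) j \<le> C} = insert i {j \<in> set L. finish c L j \<le> C - c i}"
      using True Cons.prems(1) by (auto split: if_splits)
    then have "sum c {j \<in> set (i # L). finish c (i # L) j \<le> C} =
        c i + sum c {j \<in> set L. finish c L j \<le> C - c i}"
      using Cons.prems(1) by simp
    then show ?thesis using Cons.IH[of "C - c i"] Cons.prems True by simp
  next
    case False
    have "{j \<in> set (i # L). finish c (i # L) j \<le> C} = {}"
      using False nonneg by (auto split: if_splits) (smt (verit))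
    then show ?thesis using Cons.prems(3) by (simp only: sum.empty)
  qed
qed simp

text \<open>Testing along \<open>L\<close> stops at the \<open>m\<close>-th \<open>b\<close>. All
  tests made until then are completed by time \<open>list_cost\<close>, so they already contain a
  certificate.\<close>

lemma list_cost_prefix:
  assumes "distinct L" "\<And>i. i \<in> set L \<Longrightarrow> 0 \<le> c i" "m \<le> card {i \<in> set L. x i = b}"
  shows "0 \<le> list_cost c b L m x \<and>
    m \<le> card {i \<in> set L. x i = b \<and> finish c L i \<le> list_cost c b L m x}"
  using assms
proof (induction L arbitrary: m)
  case (Cons i L)
  show ?case
  proof (cases m)
    case (Suc m')
    define m1 where "m1 = (if x i = b then m' else m)"
    have lc: "list_cost c b (i # L) m x = c i + list_cost c b L m1 x"
      by (simp add: m1_def Suc)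
    have ci: "{j \<in> set (i # L). x j = b} = (if x i = b then {i} else {}) \<union> {j \<in> set L. x j = b}"
      by auto
    have "m1 \<le> card {j \<in> set L. x j = b}"
      using Cons.prems(1,3) unfolding ci by (auto simp: m1_def Suc split: if_splits)
    then have IH: "0 \<le> list_cost c b L m1 x"
      "m1 \<le> card {j \<in> set L. x j = b \<and> finish c L j \<le> list_cost c b L m1 x}" (is "_ \<le> card ?P")
      using Cons by auto
    have "{j \<in> set (i # L). x j = b \<and> finish c (i # L) j \<le> list_cost c b (i # L) m x} =
        (if x i = b then {i} else {}) \<union> ?P"
      unfolding lc using Cons.prems(1) IH(1) by auto
    moreover have "m \<le> card ((if x i = b then {i} else {}) \<union> ?P)"
      using IH(2) Cons.prems(1) by (auto simp: m1_def Suc)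
    ultimately show ?thesis using IH(1) Cons.prems(2)[of i] unfolding lc by simp
  qed simp
qed auto

section \<open>Lower bound for arbitrary policies\<close>

definition weight :: "(nat \<Rightarrow> real) \<Rightarrow> bool \<Rightarrow> nat \<Rightarrow> real" where
  "weight p b i = (if b then p i else 1 - p i)"

text \<open>Conditioned on a state, the input is again product distributed, with probabilities 0 and
  1 for the known variables.\<close>

definition cond_prob :: "(nat \<Rightarrow> real) \<Rightarrow> state \<Rightarrow> nat \<Rightarrow> real" where
  "cond_prob p s i = (case s i of None \<Rightarrow> p i | Some v \<Rightarrow> of_bool v)"

abbreviation cond_E :: "nat \<Rightarrow> (nat \<Rightarrow> real) \<Rightarrow> state \<Rightarrow> ((nat \<Rightarrow> bool) \<Rightarrow> real) \<Rightarrow> real" where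
  "cond_E n p s \<equiv> measure_pmf.expectation (input_pmf n (cond_prob p s))"

lemma cond_E_split:
  assumes "j \<in> {1..n}" "s j = None" "0 \<le> p j" "p j \<le> 1"
  shows "cond_E n p s g = weight p b j * cond_E n p (s(j \<mapsto> b)) g
    + (1 - weight p b j) * cond_E n p (s(j \<mapsto> \<not> b)) g"
proof -
  have "(cond_prob p s)(j := 1) = cond_prob p (s(j \<mapsto> True))"
    "(cond_prob p s)(j := 0) = cond_prob p (s(j \<mapsto> False))"
    by (auto simp: cond_prob_def fun_eq_iff)
  moreover have "cond_prob p s j = p j" using assms by (simp add: cond_prob_def)
  ultimately show ?thesis
    using input_expectation_split[of j n "cond_prob p s" g] assms
    by (cases b) (simp_all add: weight_def)
qed

lemma cond_E_follows:
  assumes "x \<in> set_pmf (input_pmf n (cond_prob p s))" "i \<in> {1..n}" "s i = Some v"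
  shows "x i = v"
proof (rule ccontr)
  assume "x i \<noteq> v"
  then have "pmf (bernoulli_pmf (cond_prob p s i)) (x i) = 0"
    using assms(3) by (cases v) (auto simp: cond_prob_def)
  then have "(\<Prod>j\<in>{1..n}. pmf (bernoulli_pmf (cond_prob p s j)) (x j)) = 0"
    using assms(2) by (intro prod_zero) auto
  then have "pmf (input_pmf n (cond_prob p s)) x = 0"
    by (simp add: input_pmf_def pmf_Pi)
  with assms(1) show False by (simp add: set_pmf_iff)
qed

definition deficit :: "nat \<Rightarrow> nat \<Rightarrow> bool \<Rightarrow> state \<Rightarrow> nat" where
  "deficit n k b s = quota n k b - card {i. s i = Some b}"

lemma finite_observations:
  fixes s :: state
  assumes "dom s \<subseteq> {1..n}"
  shows "finite {i. s i = Some b}"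
  by (rule finite_subset[of _ "{1..n}"]) (use assms in auto)

lemma deficit_upd:
  assumes "dom s \<subseteq> {1..n}" "s j = None"
  shows "deficit n k b (s(j \<mapsto> b)) = deficit n k b s - 1"
    "deficit n k b (s(j \<mapsto> \<not> b)) = deficit n k b s"
proof -
  have "{i. (s(j \<mapsto> b)) i = Some b} = insert j {i. s i = Some b}"
    "{i. (s(j \<mapsto> \<not> b)) i = Some b} = {i. s i = Some b}"
    using assms(2) by auto
  then show "deficit n k b (s(j \<mapsto> b)) = deficit n k b s - 1"
    "deficit n k b (s(j \<mapsto> \<not> b)) = deficit n k b s"
    using assms finite_observations[OF assms(1)] by (simp_all add: deficit_def)
qed

lemma deficit_eq_0D:
  assumes "k \<le> n" "dom s \<subseteq> {1..n}" "deficit n k b s = 0"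
    and x: "x \<in> set_pmf (input_pmf n (cond_prob p s))"
  shows "k_of_n k n x = b"
proof -
  have "{i. s i = Some b} \<subseteq> {i \<in> {1..n}. x i = b}"
    using cond_E_follows[OF x] assms(2) by auto
  then have "card {i. s i = Some b} \<le> card {i \<in> {1..n}. x i = b}"
    by (intro card_mono) auto
  then show ?thesis
    using assms(3) unfolding k_of_n_quota[OF assms(1)] deficit_def by linarith
qed

text \<open>Conditioning on the next variable of \<open>L\<close> reproduces the recursions of
  \<open>success\<close> and \<open>success_cost\<close>. Success coincides with
  \<open>k_of_n k n x = b\<close> because \<open>L\<close> lists every unknown variable.\<close>

lemma list_cost_expectation:
  assumes "k \<le> n" "\<And>i. i \<in> {1..n} \<Longrightarrow> 0 \<le> p i \<and> p i \<le> 1"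
    and "distinct L" "set L = {1..n} - dom s" "dom s \<subseteq> {1..n}"
  shows "cond_E n p s (\<lambda>x. of_bool (k_of_n k n x = b)) = success (weight p b) L (deficit n k b s) \<and>
    cond_E n p s (\<lambda>x. of_bool (k_of_n k n x = b) * list_cost c b L (deficit n k b s) x) =
      success_cost c (weight p b) L (deficit n k b s)"
  using assms(3-)
proof (induction L arbitrary: s)
  case Nil
  show ?case
  proof (cases "deficit n k b s")
    case 0
    have "cond_E n p s (\<lambda>x. of_bool (k_of_n k n x = b)) = cond_E n p s (\<lambda>_. 1)"
      using deficit_eq_0D[OF assms(1) Nil(3) 0] by (intro pmf_expectation_cong) auto
    with 0 show ?thesis by simp
  next
    case (Suc m)
    have "k_of_n k n x \<noteq> b" if x: "x \<in> set_pmf (input_pmf n (cond_prob p s))" for x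
    proof -
      have all: "\<exists>v. s i = Some v" if "i \<in> {1..n}" for i
        using Nil(2) that by auto
      have "s i = Some b \<longleftrightarrow> i \<in> {1..n} \<and> x i = b" for i
      proof
        assume "s i = Some b"
        then show "i \<in> {1..n} \<and> x i = b" using cond_E_follows[OF x, of i b] Nil(3) by auto
      next
        assume i: "i \<in> {1..n} \<and> x i = b"
        then obtain v where "s i = Some v" using all by blast
        with i show "s i = Some b" using cond_E_follows[OF x, of i v] by auto
      qed
      then have "{i. s i = Some b} = {i \<in> {1..n}. x i = b}" by blast
      with Suc show ?thesis unfolding k_of_n_quota[OF assms(1)] deficit_def by simp
    qed
    then have "cond_E n p s (\<lambda>x. of_bool (k_of_n k n x = b)) = cond_E n p s (\<lambda>_. 0)"
      by (intro pmf_expectation_cong) auto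
    with Suc show ?thesis by simp
  qed
next
  case (Cons j L)
  have j: "j \<in> {1..n}" "s j = None" using Cons.prems(2) by auto
  show ?case
  proof (cases "deficit n k b s")
    case 0
    have "cond_E n p s (\<lambda>x. of_bool (k_of_n k n x = b)) = cond_E n p s (\<lambda>_. 1)"
      using deficit_eq_0D[OF assms(1) Cons(4) 0] by (intro pmf_expectation_cong) auto
    with 0 show ?thesis by simp
  next
    case (Suc m)
    let ?w = "weight p b" and ?F = "\<lambda>x. of_bool (k_of_n k n x = b) :: real"
    have IH: "cond_E n p (s(j \<mapsto> v)) ?F = success ?w L (deficit n k b (s(j \<mapsto> v)))"
      "cond_E n p (s(j \<mapsto> v)) (\<lambda>x. ?F x * list_cost c b L (deficit n k b (s(j \<mapsto> v))) x) =
        success_cost c ?w L (deficit n k b (s(j \<mapsto> v)))" for v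
    proof -
      have "set L = {1..n} - dom (s(j \<mapsto> v))" using Cons.prems(1,2) by auto
      moreover have "dom (s(j \<mapsto> v)) \<subseteq> {1..n}" using Cons.prems(3) j(1) by auto
      moreover have "distinct L" using Cons.prems(1) by simp
      ultimately show "cond_E n p (s(j \<mapsto> v)) ?F = success ?w L (deficit n k b (s(j \<mapsto> v)))"
        "cond_E n p (s(j \<mapsto> v)) (\<lambda>x. ?F x * list_cost c b L (deficit n k b (s(j \<mapsto> v))) x) =
        success_cost c ?w L (deficit n k b (s(j \<mapsto> v)))"
        using Cons.IH by blast+
    qed
    have d: "deficit n k b (s(j \<mapsto> b)) = m" "deficit n k b (s(j \<mapsto> \<not> b)) = Suc m"
      using deficit_upd[OF Cons.prems(3) j(2)] Suc by auto
    note split = cond_E_split[where n = n and s = s and j = j and p = p and b = b, OF j]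
    have 1: "cond_E n p s ?F = success ?w (j # L) (Suc m)"
      using assms(2)[OF j(1)] IH(1)[of b] IH(1)[of "\<not> b"] unfolding d by (subst split) auto
    have shift: "cond_E n p (s(j \<mapsto> v)) (\<lambda>x. ?F x * list_cost c b (j # L) (Suc m) x) =
        c j * cond_E n p (s(j \<mapsto> v)) ?F +
        cond_E n p (s(j \<mapsto> v)) (\<lambda>x. ?F x * list_cost c b L (if v = b then m else Suc m) x)" for v
    proof -
      have "cond_E n p (s(j \<mapsto> v)) (\<lambda>x. ?F x * list_cost c b (j # L) (Suc m) x) =
        cond_E n p (s(j \<mapsto> v)) (\<lambda>x. c j * ?F x + ?F x * list_cost c b L (if v = b then m else Suc m) x)"
        using cond_E_follows[of _ n p "s(j \<mapsto> v)" j v] j(1)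
        by (intro pmf_expectation_cong) (auto simp: algebra_simps)
      then show ?thesis by simp
    qed
    have "cond_E n p s (\<lambda>x. ?F x * list_cost c b (j # L) (Suc m) x) =
        ?w j * (c j * success ?w L m + success_cost c ?w L m) +
        (1 - ?w j) * (c j * success ?w L (Suc m) + success_cost c ?w L (Suc m))"
      using assms(2)[OF j(1)] IH(1)[of b] IH(1)[of "\<not> b"] IH(2)[of b] IH(2)[of "\<not> b"]
      unfolding d by (subst split) (auto simp only: shift, simp_all)
    also have "\<dots> = success_cost c ?w (j # L) (Suc m)"
      by (simp add: algebra_simps)
    finally show ?thesis using 1 unfolding Suc by blast
  qed
qed

text \<open>Suppose that the policy tests \<open>j\<close> next. By induction its continuation costs
  at least as much as \<open>L\<close> without \<open>j\<close>, so it does no better than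
  \<open>j\<close> followed by the rest of \<open>L\<close>; by exchange, that is no better than
  \<open>L\<close>. The first summand is the cost already paid in \<open>s\<close>.\<close>

lemma policy_cost_ge:
  assumes kn: "k \<le> n" and p: "\<And>i. i \<in> {1..n} \<Longrightarrow> 0 \<le> p i \<and> p i \<le> 1"
    and pol: "is_policy n \<pi>" and c: "\<And>i. i \<in> {1..n} \<Longrightarrow> 0 \<le> c i"
    and "sorted_wrt (\<lambda>i j. c i * weight p b j \<le> c j * weight p b i) L"
    and "distinct L" "set L = {1..n} - dom s" "dom s \<subseteq> {1..n}"
  shows "sum c (dom s) * success (weight p b) L (deficit n k b s) +
      success_cost c (weight p b) L (deficit n k b s) \<le>
    cond_E n p s (\<lambda>x. of_bool (k_of_n k n x = b) * sum c (dom (run n (k_of_n k n) \<pi> s x)))"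
  using assms(5-)
proof (induction "length L" arbitrary: s L rule: less_induct)
  case (less L s)
  let ?f = "k_of_n k n" and ?w = "weight p b" and ?d = "deficit n k b"
  let ?F = "\<lambda>x. of_bool (k_of_n k n x = b) :: real"
  show ?case
  proof (cases "determined n ?f s")
    case True
    have "success_cost c ?w L (?d s) = 0"
    proof (cases "quota n k b \<le> card {i. s i = Some b}")
      case True
      then show ?thesis by (simp add: deficit_def)
    next
      case False
      obtain v where v: "quota n k v \<le> card {i. s i = Some v}"
        using \<open>determined n ?f s\<close> unfolding determined_k_of_n[OF kn less.prems(4)] by blast
      with False have "v = (\<not> b)" by (cases "v = b") auto
      with v have q: "quota n k (\<not> b) \<le> card {i. s i = Some (\<not> b)}" by simp
      have fin: "finite {i. s i = Some v}" for v using finite_observations[OF less.prems(4)] .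
      have "i \<in> dom s \<longleftrightarrow> s i = Some b \<or> s i = Some (\<not> b)" for i
        by (cases "s i") auto
      then have "dom s = {i. s i = Some b} \<union> {i. s i = Some (\<not> b)}" by blast
      then have "card (dom s) = card {i. s i = Some b} + card {i. s i = Some (\<not> b)}"
        using fin by (simp, subst card_Un_disjoint) auto
      moreover have "length L = n - card (dom s)"
        using less.prems(2,3,4) distinct_card[of L] by (simp add: card_Diff_subset finite_subset)
      \<comment> \<open>The two quotas add up to \<open>n + 1\<close>, so once the quota of
        \<open>\<not> b\<close> is met, too few variables remain for \<open>b\<close>.\<close>
      ultimately have "length L < ?d s"
        using q False kn unfolding deficit_def quota_def by (auto split: if_splits)
      then show ?thesis by (rule success_cost_eq_0)
    qed
    moreover have "run n ?f \<pi> s x = s" for x using True by (subst run_unfold) simp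
    ultimately show ?thesis 
      using list_cost_expectation[OF kn _ less.prems(2,3,4), of p b c] p by simp
  next
    case False
    define j where "j = \<pi> s"
    have j: "j \<in> {1..n}" "s j = None"
      using policyD[OF pol less.prems(4) False] by (simp_all add: j_def)
    have run: "run n ?f \<pi> s x = run n ?f \<pi> (s(j \<mapsto> x j)) x" for x
      using False by (subst run_unfold) (simp add: j_def)
    have "j \<in> set L" using j less.prems(3) by auto
    then obtain L1 L2 where L: "L = L1 @ j # L2" by (auto simp: in_set_conv_decomp)
    let ?L = "L1 @ L2"
    have L': "sorted_wrt (\<lambda>i j. c i * ?w j \<le> c j * ?w i) ?L" "distinct ?L"
      using less.prems(1,2) unfolding L by (auto simp: sorted_wrt_append)
    have setL': "set ?L = {1..n} - dom (s(j \<mapsto> v))" for v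
      using less.prems(2,3) unfolding L by auto
    have dom': "dom (s(j \<mapsto> v)) \<subseteq> {1..n}" for v using less.prems(4) j(1) by auto
    have "?d s \<noteq> 0"
      using False unfolding determined_k_of_n[OF kn less.prems(4)] deficit_def by auto
    then obtain m where m: "?d s = Suc m" by (cases "?d s") auto
    have d: "?d (s(j \<mapsto> b)) = m" "?d (s(j \<mapsto> \<not> b)) = Suc m"
      using deficit_upd[OF less.prems(4) j(2)] m by auto
    have sum': "sum c (dom (s(j \<mapsto> v))) = sum c (dom s) + c j" for v
      using j less.prems(4) by (simp add: finite_subset domIff)
    let ?R = "\<lambda>v. cond_E n p (s(j \<mapsto> v)) (\<lambda>x. ?F x * sum c (dom (run n ?f \<pi> s x)))"
    have IH: "(sum c (dom s) + c j) * success ?w ?L (?d (s(j \<mapsto> v))) + success_cost c ?w ?L (?d (s(j \<mapsto> v)))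
        \<le> ?R v" for v
    proof -
      have "?R v = cond_E n p (s(j \<mapsto> v)) (\<lambda>x. ?F x * sum c (dom (run n ?f \<pi> (s(j \<mapsto> v)) x)))"
      proof (rule pmf_expectation_cong)
        fix x assume "x \<in> set_pmf (input_pmf n (cond_prob p (s(j \<mapsto> v))))"
        then have "x j = v" using cond_E_follows[of x n p "s(j \<mapsto> v)" j v] j(1) by simp
        then show "?F x * sum c (dom (run n ?f \<pi> s x)) =
            ?F x * sum c (dom (run n ?f \<pi> (s(j \<mapsto> v)) x))"
          using run[of x] by simp
      qed
      then show ?thesis
        using less.hyps[of ?L "s(j \<mapsto> v)"] L' setL' dom' sum'[of v]
          by (simp add: L)
    qed
    have w: "0 \<le> ?w i" "?w i \<le> 1" if "i \<in> {1..n}" for i using p[OF that] by (auto simp: weight_def)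
    have "success_cost c ?w L (Suc m) \<le> success_cost c ?w (j # ?L) (Suc m)"
      unfolding L
    proof (rule success_cost_move_front)
      fix i assume i: "i \<in> set L1"
      then have "i \<in> set L" by (simp add: L)
      then have "i \<in> {1..n}" using less.prems(3) by blast
      with i show "c i * ?w j \<le> c j * ?w i" "0 \<le> ?w i \<and> ?w i \<le> 1"
        using less.prems(1,3) w[of i] unfolding L by (auto simp: sorted_wrt_append)
    qed
    moreover have "success ?w L (Suc m) = success ?w (j # ?L) (Suc m)"
      unfolding L by (rule success_move_front)
    ultimately have "sum c (dom s) * success ?w L (?d s) + success_cost c ?w L (?d s) \<le>
        sum c (dom s) * success ?w (j # ?L) (Suc m) + success_cost c ?w (j # ?L) (Suc m)"
      unfolding m by (simp only: add_le_cancel_left)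
    also have "\<dots> = ?w j * ((sum c (dom s) + c j) * success ?w ?L m + success_cost c ?w ?L m) +
        (1 - ?w j) * ((sum c (dom s) + c j) * success ?w ?L (Suc m) + success_cost c ?w ?L (Suc m))"
      by (simp add: algebra_simps)
    also have "\<dots> \<le> ?w j * ?R b + (1 - ?w j) * ?R (\<not> b)"
      using IH[of b] IH[of "\<not> b"] w[OF j(1)] unfolding d by (intro add_mono mult_left_mono) auto
    also have "\<dots> = cond_E n p s (\<lambda>x. ?F x * sum c (dom (run n ?f \<pi> s x)))"
      using p[OF j(1)] by (subst cond_E_split[where n = n and s = s and j = j and p = p and b = b, OF j]) auto
    finally show ?thesis .
  qed
qed

section \<open>The adaptivity gap is at most 2\<close>

lemma nonadaptive_2_approx:
  assumes kn: "k \<le> n" and p: "\<And>i. i \<in> {1..n} \<Longrightarrow> 0 < p i \<and> p i < 1"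
    and c: "\<And>i. i \<in> {1..n} \<Longrightarrow> 0 \<le> c i"
  shows "expected_cost n (k_of_n k n) c p (OPT_NA n (k_of_n k n) c p) \<le>
    2 * expected_cost n (k_of_n k n) c p (OPT n (k_of_n k n) c p)"
proof -
  let ?f = "k_of_n k n" and ?E = "measure_pmf.expectation (input_pmf n p)"
  define L where "L = (\<lambda>b. sort_key (\<lambda>i. c i / weight p b i) [1..<Suc n])"
  have L: "distinct (L b)" "set (L b) = {1..n}" for b by (auto simp: L_def)
  have Ls: "sorted_wrt (\<lambda>i j. c i * weight p b j \<le> c j * weight p b i) (L b)" for b
  proof (rule sorted_wrt_mono_rel)
    show "sorted_wrt (\<lambda>i j. c i / weight p b i \<le> c j / weight p b j) (L b)"
      using sorted_sort_key[of "\<lambda>i. c i / weight p b i" "[1..<Suc n]"]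
      by (simp add: L_def sorted_wrt_map)
    fix i j assume "i \<in> set (L b)" "j \<in> set (L b)" "c i / weight p b i \<le> c j / weight p b j"
    moreover from this have "0 < weight p b i" "0 < weight p b j"
      using p L by (auto simp: weight_def)
    ultimately show "c i * weight p b j \<le> c j * weight p b i" by (simp add: field_simps)
  qed
  have start: "cond_prob p Map.empty = p" "deficit n k b Map.empty = quota n k b" for b
    by (auto simp: cond_prob_def deficit_def)
  define C where "C = (\<lambda>b x. list_cost c b (L b) (quota n k b) x)"
  have lower: "?E (\<lambda>x. of_bool (?f x = b) * C b x) \<le> ?E (\<lambda>x. of_bool (?f x = b) * cost n ?f c \<pi> x)"
    if "is_policy n \<pi>" for \<pi> b
    using policy_cost_ge[OF kn _ that c Ls L(1), where s = Map.empty]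
      list_cost_expectation[OF kn _ L(1), where p = p and s = Map.empty and b = b and c = c] p L(2)[of b]
    by (simp add: start C_def cost_def final_state_run less_imp_le)
  \<comment> \<open>The time at which \<open>i\<close> is first completed when both orders are
    processed in parallel at equal speed. Sorting by it merges the two orders.\<close>
  define T where "T = (\<lambda>i. min (finish c (L True) i) (finish c (L False) i))"
  define Ord where "Ord = sort_key T [1..<Suc n]"
  have Ord: "distinct Ord" "set Ord = {1..n}" "sorted (map T Ord)" by (auto simp: Ord_def)
  have na: "is_nonadaptive n (order_policy Ord)" by (rule is_nonadaptive_order[OF Ord(1,2)])
  then have pol: "is_policy n (order_policy Ord)" by (simp add: is_nonadaptive_def)
  have upper: "cost n ?f c (order_policy Ord) x \<le> 2 * C b x" if b: "?f x = b" for x b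
  proof -
    let ?P = "{i \<in> {1..n}. x i = b \<and> finish c (L b) i \<le> C b x}"
    have C: "0 \<le> C b x" "quota n k b \<le> card ?P"
      using list_cost_prefix[OF L(1), of b c "quota n k b" x b] c b L(2)[of b]
      unfolding C_def k_of_n_quota[OF kn] by auto
    have TL: "T i \<le> finish c (L b) i" for i by (cases b) (auto simp: T_def)
    have "cost n ?f c (order_policy Ord) x \<le> sum c ({1..n} \<inter> {i. T i \<le> C b x})"
    proof (rule cost_le_of_invariant[OF pol c])
      fix S assume S: "S \<subseteq> {1..n} \<inter> {i. T i \<le> C b x}" "\<not> determined n ?f (observed x S)"
      \<comment> \<open>\<open>?P\<close> certifies the value, so some \<open>i\<close> in it is
        untested. Since \<open>T i\<close> is at most \<open>C b x\<close>, the variable with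
        minimal \<open>T\<close> stays within this bound too.\<close>
      have "\<not> ?P \<subseteq> S"
      proof
        assume "?P \<subseteq> S"
        then have "card ?P \<le> card {i \<in> S. x i = b}"
          using S(1) finite_subset[of S "{1..n}"] by (intro card_mono) auto
        with C(2) S show False by (subst (asm) determined_observed[OF kn]) (auto intro: le_trans)
      qed
      then obtain i where i: "i \<in> ?P" "i \<notin> S" by blast
      then have "T (order_policy Ord (observed x S)) \<le> T i"
        using order_policy_min[OF Ord(3)] Ord(2) by simp
      with i TL[of i] show "order_policy Ord (observed x S) \<in> {i. T i \<le> C b x}" by auto
    qed auto
    also have "{1..n} \<inter> {i. T i \<le> C b x} =
        {i \<in> {1..n}. finish c (L True) i \<le> C b x} \<union> {i \<in> {1..n}. finish c (L False) i \<le> C b x}"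
      by (auto simp: T_def min_le_iff_disj)
    also have "sum c \<dots> \<le> sum c {i \<in> {1..n}. finish c (L True) i \<le> C b x}
        + sum c {i \<in> {1..n}. finish c (L False) i \<le> C b x}"
      using c by (subst sum.union_inter[symmetric]) (auto intro!: sum_nonneg)
    \<comment> \<open>By time \<open>C b x\<close> each of the two orders has spent at most
      \<open>C b x\<close>.\<close>
    also have "\<dots> \<le> 2 * C b x"
      using sum_finish_le[OF L(1)[of True], of c "C b x"] sum_finish_le[OF L(1)[of False], of c "C b x"]
        c C(1) L(2) by simp
    finally show ?thesis .
  qed
  have both: "?E g = ?E (\<lambda>x. of_bool (?f x = True) * g x) + ?E (\<lambda>x. of_bool (?f x = False) * g x)" for g :: "(nat \<Rightarrow> bool) \<Rightarrow> real"
  proof -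
    have "?E g = ?E (\<lambda>x. of_bool (?f x = True) * g x + of_bool (?f x = False) * g x)"
      by (intro pmf_expectation_cong) auto
    also have "\<dots> = ?E (\<lambda>x. of_bool (?f x = True) * g x) + ?E (\<lambda>x. of_bool (?f x = False) * g x)"
      by (rule Bochner_Integration.integral_add) (rule integrable_input)+
    finally show ?thesis .
  qed
  let ?O = "OPT n ?f c p"
  have "expected_cost n ?f c p (OPT_NA n ?f c p) \<le> ?E (cost n ?f c (order_policy Ord))"
    using OPT_properties(4)[OF na] by (simp add: expected_cost_def)
  also have "\<dots> = ?E (\<lambda>x. of_bool (?f x = True) * cost n ?f c (order_policy Ord) x)
      + ?E (\<lambda>x. of_bool (?f x = False) * cost n ?f c (order_policy Ord) x)"
    by (rule both)
  also have "\<dots> \<le> ?E (\<lambda>x. 2 * (of_bool (?f x = True) * C True x))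
      + ?E (\<lambda>x. 2 * (of_bool (?f x = False) * C False x))"
    using upper[of _ True] upper[of _ False] by (intro add_mono input_expectation_mono) auto
  also have "\<dots> = 2 * (?E (\<lambda>x. of_bool (?f x = True) * C True x)
      + ?E (\<lambda>x. of_bool (?f x = False) * C False x))"
    by simp
  also have "\<dots> \<le> 2 * (?E (\<lambda>x. of_bool (?f x = True) * cost n ?f c ?O x)
      + ?E (\<lambda>x. of_bool (?f x = False) * cost n ?f c ?O x))"
    using lower[OF OPT_properties(1), of True] lower[OF OPT_properties(1), of False]
    by (intro mult_left_mono add_mono) simp_all
  also have "\<dots> = 2 * expected_cost n ?f c p ?O"
    unfolding expected_cost_def by (subst both[of "cost n ?f c ?O"]) simp
  finally show ?thesis .
qed

section \<open>Instances with adaptivity gap close to 2\<close>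

text \<open>
  Harmonic-type costs: the \<open>j\<close> cheapest of \<open>unit_cost 1, \<dots>, unit_cost a\<close> add up to
  \<open>1 / (a + 1 - j) - 1 / (a + 1)\<close>.
\<close>

definition unit_cost :: "nat \<Rightarrow> real" where
  "unit_cost l = 1 / (real l * (real l + 1))"

lemma unit_cost_nonneg [simp]: "0 \<le> unit_cost l"
  by (simp add: unit_cost_def)

lemma unit_cost_antimono: "0 < i \<Longrightarrow> i \<le> j \<Longrightarrow> unit_cost j \<le> unit_cost i"
  unfolding unit_cost_def by (intro divide_left_mono mult_mono mult_pos_pos) auto

text \<open>Telescoping, as \<open>unit_cost i\<close> is
  \<open>1 / i - 1 / (i + 1)\<close>.\<close>

lemma sum_unit_cost:
  assumes "0 < l" "l \<le> Suc a"
  shows "(\<Sum>i=l..a. unit_cost i) = 1 / real l - 1 / (real a + 1)"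
  using assms
proof (induction a)
  case 0
  then show ?case by simp
next
  case (Suc a)
  show ?case
  proof (cases "l \<le> Suc a")
    case True
    have "unit_cost (Suc a) = 1 / (real a + 1) - 1 / (real (Suc a) + 1)"
      by (simp add: unit_cost_def divide_simps)
    with True Suc show ?thesis by simp
  next
    case False
    with Suc.prems have "l = Suc (Suc a)" by simp
    then show ?thesis by simp
  qed
qed

lemma sum_unit_cost_le:
  assumes "0 < l"
  shows "(\<Sum>i=l..a. unit_cost i) \<le> 1 / real l"
  using sum_unit_cost[of l a] assms by (cases "l \<le> Suc a") auto

text \<open>Going from \<open>a\<close> to \<open>Suc a\<close> adds \<open>2 * a + 1\<close> pairs,
  all with minimum \<open>unit_cost (Suc a)\<close> since the costs decrease. The induction needs
  the exact value.\<close>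

lemma sum_min_unit_cost:
  "(\<Sum>i=1..a. \<Sum>j=1..a. min (unit_cost i) (unit_cost j)) \<ge> 2 * harm a - 3"
proof -
  have "(\<Sum>i=1..a. \<Sum>j=1..a. min (unit_cost i) (unit_cost j)) = 2 * harm a - 3 + 3 / (real a + 1)"
  proof (induction a)
    case 0
    show ?case by (simp add: harm_def)
  next
    case (Suc a)
    let ?m = "\<lambda>i j. min (unit_cost i) (unit_cost j)"
    have m: "?m i (Suc a) = unit_cost (Suc a)" "?m (Suc a) i = unit_cost (Suc a)"
      if "i \<in> {1..a}" for i
      using that unit_cost_antimono[of i "Suc a"] by (auto simp: min_def)
    have "(\<Sum>i=1..Suc a. \<Sum>j=1..Suc a. ?m i j) =
        (\<Sum>i=1..a. \<Sum>j=1..a. ?m i j) + (\<Sum>i=1..a. ?m i (Suc a)) + (\<Sum>j=1..a. ?m (Suc a) j)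
        + unit_cost (Suc a)"
      by (simp add: sum.distrib)
    also have "\<dots> = 2 * harm a - 3 + 3 / (real a + 1) + (2 * real a + 1) * unit_cost (Suc a)"
      unfolding Suc using m by (simp add: algebra_simps)
    also have "\<dots> = 2 * harm (Suc a) - 3 + 3 / (real (Suc a) + 1)"
      by (simp add: harm_Suc unit_cost_def divide_simps) (simp add: algebra_simps)
    finally show ?case .
  qed
  then show ?thesis by simp
qed

text \<open>
  There are \<open>2 * M\<close> free fair coins. Their number of ones decides how many
  further ones are missing, almost uniformly between 1 and \<open>2 * a\<close>. Variables in \<open>Ones\<close> are
  almost surely 1 and those in \<open>Zeros\<close> almost surely 0. When at most \<open>a\<close> further ones are
  missing, only variables in \<open>Ones\<close> help to certify the value of the function; otherwise only
  those in \<open>Zeros\<close> do.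
\<close>

locale gap_instance =
  fixes a M :: nat and e :: real
  assumes a: "1 \<le> a" "a \<le> M" and e: "0 < e" "e < 1"
begin

definition n where "n = 2 * a + 2 * M"
text \<open>On a typical input there are \<open>a + heads x\<close> ones, so the function is 1
  exactly if \<open>heads x\<close> is at least \<open>M\<close>.\<close>

definition k where "k = M + a"
abbreviation f where "f \<equiv> k_of_n k n"

definition Ones where "Ones = {1..a}"
definition Zeros where "Zeros = {Suc a..2 * a}"
definition Coins where "Coins = {Suc (2 * a)..n}"

definition c :: "nat \<Rightarrow> real" where
  "c i = (if i \<le> a then unit_cost i else if i \<le> 2 * a then unit_cost (i - a) else 0)"

definition p :: "nat \<Rightarrow> real" where
  "p i = (if i \<le> a then 1 - e else if i \<le> 2 * a then e else 1 / 2)"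

abbreviation E :: "((nat \<Rightarrow> bool) \<Rightarrow> real) \<Rightarrow> real" where
  "E \<equiv> measure_pmf.expectation (input_pmf n p)"

definition typical :: "(nat \<Rightarrow> bool) \<Rightarrow> bool" where
  "typical x \<longleftrightarrow> (\<forall>i\<in>Ones. x i) \<and> (\<forall>i\<in>Zeros. \<not> x i)"

definition heads :: "(nat \<Rightarrow> bool) \<Rightarrow> nat" where
  "heads x = card {i \<in> Coins. x i}"

lemma instance_mem: "(n, f, c, p) \<in> instances"
  using a e unfolding instances_def
  by (auto simp: n_def k_def c_def p_def intro!: bexI[of _ "M + a"])

lemma p_bounds: "0 < p i" "p i < 1"
  using e by (auto simp: p_def)

lemma parts: "{1..n} = Ones \<union> Zeros \<union> Coins" "Ones \<inter> Zeros = {}" "Ones \<inter> Coins = {}"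
  "Zeros \<inter> Coins = {}"
  by (auto simp: Ones_def Zeros_def Coins_def n_def)

lemma parts_finite [simp]: "finite Ones" "finite Zeros" "finite Coins"
  by (auto simp: Ones_def Zeros_def Coins_def)

lemma parts_card [simp]: "card Ones = a" "card Zeros = a" "card Coins = 2 * M"
  by (auto simp: Ones_def Zeros_def Coins_def n_def)

lemma quota: "quota n k True = M + a" "quota n k False = M + a + 1"
  by (auto simp: quota_def n_def k_def)

lemma kn: "k \<le> n"
  by (simp add: k_def n_def)

lemma c_nonneg [simp]: "0 \<le> c i"
  by (simp add: c_def)

lemma c_coins: "i \<in> Coins \<Longrightarrow> c i = 0"
  by (simp add: c_def Coins_def)

lemma tails: "card {i \<in> Coins. \<not> x i} = 2 * M - heads x" "heads x \<le> 2 * M"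
proof -
  have "card {i \<in> Coins. \<not> x i} = card (Coins - {i \<in> Coins. x i})"
    by (intro arg_cong[of _ _ card]) auto
  then show "card {i \<in> Coins. \<not> x i} = 2 * M - heads x"
    by (simp add: card_Diff_subset heads_def)
  show "heads x \<le> 2 * M"
    unfolding heads_def using card_mono[of Coins "{i \<in> Coins. x i}"] by auto
qed

lemma sum_c_Ones: "sum c {l..a} = (\<Sum>i=l..a. unit_cost i)"
  by (intro sum.cong) (auto simp: c_def)

lemma sum_c_Zeros: "0 < l \<Longrightarrow> sum c {a + l..2 * a} = (\<Sum>i=l..a. unit_cost i)"
  by (rule sum.reindex_bij_witness[of _ "\<lambda>i. a + i" "\<lambda>i. i - a"]) (auto simp: c_def)

lemma total_cost: "(\<Sum>i=1..n. c i) \<le> 2"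
proof -
  have "(\<Sum>i=1..n. c i) = sum c Ones + sum c Zeros + sum c Coins"
    unfolding parts(1) using parts by (subst sum.union_disjoint; simp add: Int_Un_distrib2)+
  moreover have "sum c Coins = 0" by (intro sum.neutral) (auto simp: c_coins)
  moreover have "sum c Ones \<le> 1" "sum c Zeros \<le> 1"
    using sum_c_Ones[of 1] sum_c_Zeros[of 1] sum_unit_cost_le[of 1 a]
    by (auto simp: Ones_def Zeros_def)
  ultimately show ?thesis by simp
qed

subsection \<open>An adaptive policy\<close>

text \<open>Costs decrease with the index, so the block is listed from its cheapest variable on:
  \<open>up 0\<close> lists \<open>Ones\<close>, \<open>up a\<close> lists
  \<open>Zeros\<close>.\<close>

definition up where "up l = rev [Suc l..<Suc (l + a)]"

text \<open>The coins are free and reveal which value a typical input has. The other block comes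
  last, for atypical inputs.\<close>

definition adaptive :: policy where
  "adaptive s = order_policy ([Suc (2 * a)..<Suc n] @
     (if M \<le> card {i \<in> Coins. s i = Some True} then up 0 @ up a else up a @ up 0)) s"

lemma adaptive_policy: "is_policy n adaptive"
proof (rule is_policy_order)
  fix s
  show "\<exists>L. set L = {1..n} \<and> adaptive s = order_policy L s"
    unfolding adaptive_def
    by (rule exI, rule conjI[OF _ refl]) (auto simp: up_def n_def)
qed

lemma order_policy_up:
  assumes "i \<in> {Suc l..l + a}" "i \<notin> S"
  shows "order_policy (up l @ L) (observed x S) \<in> {i..l + a}"
proof -
  have set: "set (up l) = {Suc l..l + a}" by (auto simp: up_def)
  have "order_policy (up l @ L) (observed x S) = order_policy (up l) (observed x S)"
    using assms set by (intro order_policy_append[of i]) auto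
  \<comment> \<open>\<open>up l\<close> is descending; negating the indices makes
    \<open>order_policy_min\<close> applicable.\<close>
  moreover have "sorted (map (\<lambda>j. - int j) (up l))"
    by (simp add: up_def sorted_wrt_rev sorted_wrt_map del: upt_Suc)
  then have "- int (order_policy (up l) (observed x S)) \<le> - int i"
    using assms set by (intro order_policy_min) auto
  moreover have "order_policy (up l) (observed x S) \<in> set (up l)"
    using assms set by (intro order_policy_mem(1)[of i]) auto
  ultimately show ?thesis using set by auto
qed

lemma adaptive_coins:
  assumes "\<not> Coins \<subseteq> S"
  shows "adaptive (observed x S) \<in> Coins"
proof -
  from assms obtain i where i: "i \<in> Coins" "i \<notin> S" by blast
  have set: "set [Suc (2 * a)..<Suc n] = Coins" by (auto simp: Coins_def)
  show ?thesis
    unfolding adaptive_def using i set order_policy_mem(1)[of i "[Suc (2 * a)..<Suc n]" "observed x S"]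
    by (subst order_policy_append[of i]) auto
qed

lemma adaptive_rest:
  assumes "Coins \<subseteq> S"
  shows "adaptive (observed x S) =
    order_policy (if M \<le> heads x then up 0 @ up a else up a @ up 0) (observed x S)"
proof -
  have "{i \<in> Coins. observed x S i = Some True} = {i \<in> Coins. x i}" using assms by auto
  moreover have "set [Suc (2 * a)..<Suc n] = Coins" by (auto simp: Coins_def)
  ultimately show ?thesis
    unfolding adaptive_def using assms by (subst order_policy_skip) (auto simp: heads_def)
qed

lemma cost_coins_Un:
  assumes V: "V \<subseteq> Ones \<union> Zeros"
    and step: "\<And>S. Coins \<subseteq> S \<Longrightarrow> S \<subseteq> {1..n} \<inter> (Coins \<union> V) \<Longrightarrow> \<not> determined n f (observed x S) \<Longrightarrow>
      adaptive (observed x S) \<in> V"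
  shows "cost n f c adaptive x \<le> sum c V"
proof -
  have "cost n f c adaptive x \<le> sum c ({1..n} \<inter> (Coins \<union> V))"
  proof (rule cost_le_of_invariant[OF adaptive_policy])
    fix S assume "S \<subseteq> {1..n} \<inter> (Coins \<union> V)" "\<not> determined n f (observed x S)"
    then show "adaptive (observed x S) \<in> Coins \<union> V"
      using step[of S] adaptive_coins[of S x] by (cases "Coins \<subseteq> S") auto
  qed simp
  also have "{1..n} \<inter> (Coins \<union> V) = Coins \<union> V" using V parts by auto
  also have "sum c (Coins \<union> V) = sum c Coins + sum c V"
    using V parts finite_subset[OF V] by (intro sum.union_disjoint) auto
  also have "sum c Coins = 0" by (intro sum.neutral) (auto simp: c_coins)
  finally show ?thesis by simp
qed

text \<open>\<open>M + a - heads x\<close> ones are missing after the coins, and the cheapest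
  variables of \<open>Ones\<close> supply them.\<close>

lemma cost_adaptive_ones:
  assumes x: "typical x" "M \<le> heads x"
  shows "cost n f c adaptive x \<le> (\<Sum>i=heads x - M + 1..a. unit_cost i)"
proof -
  let ?V = "{heads x - M + 1..a}"
  have "cost n f c adaptive x \<le> sum c ?V"
  proof (rule cost_coins_Un)
    show "?V \<subseteq> Ones \<union> Zeros" by (auto simp: Ones_def)
    fix S assume S: "Coins \<subseteq> S" "S \<subseteq> {1..n} \<inter> (Coins \<union> ?V)" "\<not> determined n f (observed x S)"
    have fin: "finite S" using S(2) finite_subset[of S "{1..n}"] by auto
    have "\<not> ?V \<subseteq> S"
    proof
      assume "?V \<subseteq> S"
      then have "{i \<in> Coins. x i} \<union> ?V \<subseteq> {i \<in> S. x i = True}"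
        using S(1) x(1) by (auto simp: typical_def Ones_def)
      then have "card ({i \<in> Coins. x i} \<union> ?V) \<le> card {i \<in> S. x i = True}"
        using fin by (intro card_mono) auto
      moreover have "card ({i \<in> Coins. x i} \<union> ?V) = heads x + (a - (heads x - M))"
        unfolding heads_def by (subst card_Un_disjoint) (auto simp: Coins_def)
      ultimately have "quota n k True \<le> card {i \<in> S. x i = True}"
        using x(2) unfolding quota by linarith
      then show False using S(2,3) determined_observed[OF kn, of S x] by blast
    qed
    then obtain i where "i \<in> ?V" "i \<notin> S" by blast
    then show "adaptive (observed x S) \<in> ?V"
      using order_policy_up[of i 0 S "up a" x] x(2) by (auto simp: adaptive_rest[OF S(1)])
  qed
  then show ?thesis by (simp add: sum_c_Ones)
qed

text \<open>As above, but the quota of zeros is \<open>M + a + 1\<close>, so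
  \<open>a + 1 - (M - heads x)\<close> zeros are missing. Hence the range starts at
  \<open>M - heads x\<close>, without the \<open>+ 1\<close>.\<close>

lemma cost_adaptive_zeros:
  assumes x: "typical x" "heads x < M"
  shows "cost n f c adaptive x \<le> (\<Sum>i=M - heads x..a. unit_cost i)"
proof -
  let ?V = "{a + (M - heads x)..2 * a}"
  have "cost n f c adaptive x \<le> sum c ?V"
  proof (rule cost_coins_Un)
    show "?V \<subseteq> Ones \<union> Zeros" using x(2) by (auto simp: Zeros_def)
    fix S assume S: "Coins \<subseteq> S" "S \<subseteq> {1..n} \<inter> (Coins \<union> ?V)" "\<not> determined n f (observed x S)"
    have fin: "finite S" using S(2) finite_subset[of S "{1..n}"] by auto
    have "\<not> ?V \<subseteq> S"
    proof
      assume "?V \<subseteq> S"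
      then have "{i \<in> Coins. \<not> x i} \<union> ?V \<subseteq> {i \<in> S. x i = False}"
        using S(1) x by (auto simp: typical_def Zeros_def)
      then have "card ({i \<in> Coins. \<not> x i} \<union> ?V) \<le> card {i \<in> S. x i = False}"
        using fin by (intro card_mono) auto
      moreover have "card ({i \<in> Coins. \<not> x i} \<union> ?V) = 2 * M - heads x + (a + 1 - (M - heads x))"
        unfolding tails(1)[symmetric] by (subst card_Un_disjoint) (auto simp: Coins_def)
      ultimately have "quota n k False \<le> card {i \<in> S. x i = False}"
        using x(2) unfolding quota by linarith
      then show False using S(2,3) determined_observed[OF kn, of S x] by blast
    qed
    then obtain i where i: "i \<in> ?V" "i \<notin> S" by blast
    then have "i \<in> {Suc a..a + a}" using x(2) by auto
    then show "adaptive (observed x S) \<in> ?V"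
      using order_policy_up[of i a S "up 0" x] i x(2) by (simp add: adaptive_rest[OF S(1)])
  qed
  then show ?thesis using x(2) by (simp only: sum_c_Zeros zero_less_diff)
qed

text \<open>The two bounds are partial sums from some \<open>l\<close> on, thus at most
  \<open>1 / l\<close>, and zero for \<open>l > a\<close>. Atypical inputs are charged the total
  cost, at most 2.\<close>

lemma cost_adaptive_le:
  "cost n f c adaptive x \<le>
    (\<Sum>l=1..a. of_bool (heads x = M + l - 1) / real l + of_bool (heads x = M - l) / real l)
    + 2 * of_bool (\<not> typical x)"
proof -
  let ?g = "\<lambda>l. of_bool (heads x = M + l - 1) / real l + of_bool (heads x = M - l) / real l :: real"
  have nonneg: "0 \<le> sum ?g {1..a}" by (intro sum_nonneg) auto
  have bound: "(\<Sum>i=l..a. unit_cost i) \<le> sum ?g {1..a}"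
    if l: "0 < l" "heads x = M + l - 1 \<or> heads x = M - l" for l
  proof (cases "l \<le> a")
    case True
    have "(\<Sum>i=l..a. unit_cost i) \<le> 1 / real l" using l(1) by (rule sum_unit_cost_le)
    also have "\<dots> \<le> ?g l" using l(2) by auto
    also have "\<dots> \<le> sum ?g {1..a}" using True l(1) by (intro member_le_sum) auto
    finally show ?thesis .
  qed (use nonneg in simp)
  show ?thesis
  proof (cases "typical x")
    case True
    show ?thesis
    proof (cases "M \<le> heads x")
      case le: True
      show ?thesis using cost_adaptive_ones[OF True le] bound[of "heads x - M + 1"] le True by simp
    next
      case False
      then show ?thesis using cost_adaptive_zeros[OF True] bound[of "M - heads x"] True by simp
    qed
  next
    case False
    have "cost n f c adaptive x \<le> 2"
      using cost_bounds(2)[OF adaptive_policy, of c f x] total_cost by simp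
    with False nonneg show ?thesis by simp
  qed
qed

subsection \<open>Distribution of the coins\<close>

lemma E_of_bool: "E (\<lambda>x. of_bool (P x)) = measure_pmf.prob (input_pmf n p) {x. P x}"
proof -
  have "(\<lambda>x. of_bool (P x) :: real) = indicator {x. P x}" by (auto simp: indicator_def)
  then show ?thesis by simp
qed

lemma heads_distribution: "E (\<lambda>x. of_bool (heads x = t)) = real (2 * M choose t) / 4 ^ M"
proof -
  have sub: "Coins \<subseteq> {1..n}" by (auto simp: Coins_def)
  have "binomial_pmf (2 * M) (1 / 2) =
      map_pmf (\<lambda>g. card {i \<in> Coins. g i}) (Pi_pmf Coins False (\<lambda>_. bernoulli_pmf (1 / 2)))"
    by (rule binomial_pmf_altdef') auto
  also have "Pi_pmf Coins False (\<lambda>_. bernoulli_pmf (1 / 2)) = Pi_pmf Coins False (\<lambda>i. bernoulli_pmf (p i))"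
    by (rule Pi_pmf_cong) (auto simp: Coins_def p_def)
  also have "\<dots> = map_pmf (\<lambda>g i. if i \<in> Coins then g i else False) (input_pmf n p)"
    unfolding input_pmf_def using sub by (intro Pi_pmf_subset) auto
  also have "map_pmf (\<lambda>g. card {i \<in> Coins. g i}) \<dots> = map_pmf heads (input_pmf n p)"
    unfolding map_pmf_comp heads_def by (intro map_pmf_cong refl arg_cong[of _ _ card]) auto
  finally have "pmf (binomial_pmf (2 * M) (1 / 2)) t = measure_pmf.prob (input_pmf n p) {x. heads x = t}"
    by (simp add: pmf_map vimage_def)
  then have eq: "E (\<lambda>x. of_bool (heads x = t)) = real (2 * M choose t) * (1 / 2) ^ t * (1 / 2) ^ (2 * M - t)"
    unfolding E_of_bool by simp
  show ?thesis
  proof (cases "t \<le> 2 * M")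
    case True
    then have "(1 / 2) ^ t * (1 / 2) ^ (2 * M - t) = (1 / 4 :: real) ^ M"
      by (simp add: power_add[symmetric] power_mult power2_eq_square)
    then show ?thesis unfolding eq by (simp add: power_one_over mult.assoc)
  qed (simp add: eq binomial_eq_0)
qed

text \<open>A union bound over \<open>2 * a\<close> variables, each deviating with probability
  \<open>e\<close>.\<close>

lemma atypical: "E (\<lambda>x. of_bool (\<not> typical x)) \<le> 2 * a * e"
proof -
  have comp: "E (\<lambda>x. of_bool (x i \<noteq> v)) = e"
    if i: "i \<in> Ones \<and> v \<or> i \<in> Zeros \<and> \<not> v" for i v
  proof -
    have "i \<in> {1..n}" using i parts by auto
    then have "map_pmf (\<lambda>x. x i) (input_pmf n p) = bernoulli_pmf (p i)"
      unfolding input_pmf_def by (subst Pi_pmf_component) auto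
    then have "measure_pmf.prob (input_pmf n p) {x. x i \<noteq> v} = pmf (bernoulli_pmf (p i)) (\<not> v)"
      by (simp add: pmf_map vimage_def flip: \<open>map_pmf _ _ = _\<close>)
    also have "\<dots> = e"
      using i e by (auto simp: p_def Ones_def Zeros_def)
    finally show ?thesis by (simp add: E_of_bool)
  qed
  have "E (\<lambda>x. of_bool (\<not> typical x)) \<le>
      E (\<lambda>x. (\<Sum>i\<in>Ones. of_bool (x i \<noteq> True)) + (\<Sum>i\<in>Zeros. of_bool (x i \<noteq> False)))"
  proof (rule input_expectation_mono)
    fix x
    show "of_bool (\<not> typical x) \<le>
        (\<Sum>i\<in>Ones. of_bool (x i \<noteq> True)) + (\<Sum>i\<in>Zeros. of_bool (x i \<noteq> False) :: real)"
    proof (cases "typical x")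
      case False
      then consider i where "i \<in> Ones" "\<not> x i" | i where "i \<in> Zeros" "x i"
        by (auto simp: typical_def)
      then show ?thesis
      proof cases
        case 1
        then have "1 \<le> (\<Sum>i\<in>Ones. of_bool (x i \<noteq> True) :: real)"
          using member_le_sum[of i Ones "\<lambda>i. of_bool (x i \<noteq> True) :: real"] by simp
        then show ?thesis using sum_nonneg[of Zeros "\<lambda>i. of_bool (x i \<noteq> False) :: real"] by simp
      next
        case 2
        then have "1 \<le> (\<Sum>i\<in>Zeros. of_bool (x i \<noteq> False) :: real)"
          using member_le_sum[of i Zeros "\<lambda>i. of_bool (x i \<noteq> False) :: real"] by simp
        then show ?thesis using sum_nonneg[of Ones "\<lambda>i. of_bool (x i \<noteq> True) :: real"] by simp
      qed
    qed (auto intro!: add_nonneg_nonneg sum_nonneg)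
  qed
  also have "\<dots> = (\<Sum>i\<in>Ones. E (\<lambda>x. of_bool (x i \<noteq> True))) + (\<Sum>i\<in>Zeros. E (\<lambda>x. of_bool (x i \<noteq> False)))"
    by (simp only: Bochner_Integration.integral_add Bochner_Integration.integral_sum integrable_input)
  also have "\<dots> = (\<Sum>i\<in>Ones. e) + (\<Sum>i\<in>Zeros. e)"
    using comp[of _ True] comp[of _ False] by (intro arg_cong2[of _ _ _ _ "(+)"] sum.cong) auto
  finally show ?thesis by (simp add: ac_simps)
qed

text \<open>No number of heads is likelier than \<open>M\<close>, and each \<open>l\<close> arises
  from two numbers of heads, one on each side of the threshold.\<close>

lemma OPT_le:
  "expected_cost n f c p (OPT n f c p) \<le> 2 * harm a * (real (2 * M choose M) / 4 ^ M) + 4 * a * e"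
proof -
  let ?U = "real (2 * M choose M) / 4 ^ M"
  have U: "E (\<lambda>x. of_bool (heads x = t)) \<le> ?U" for t
    unfolding heads_distribution by (intro divide_right_mono) (auto intro: binomial_maximum')
  have "expected_cost n f c p (OPT n f c p) \<le> E (cost n f c adaptive)"
    using OPT_properties(2)[OF adaptive_policy] by (simp add: expected_cost_def)
  also have "\<dots> \<le> E (\<lambda>x. (\<Sum>l=1..a. of_bool (heads x = M + l - 1) / real l + of_bool (heads x = M - l) / real l)
    + 2 * of_bool (\<not> typical x))"
    by (intro input_expectation_mono cost_adaptive_le)
  also have "\<dots> = (\<Sum>l=1..a. E (\<lambda>x. of_bool (heads x = M + l - 1)) / real l + E (\<lambda>x. of_bool (heads x = M - l)) / real l)
    + 2 * E (\<lambda>x. of_bool (\<not> typical x))"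
    by (simp only: Bochner_Integration.integral_add Bochner_Integration.integral_sum integrable_input
      integral_divide_zero integral_mult_right_zero)
  also have "\<dots> \<le> (\<Sum>l=1..a. ?U / real l + ?U / real l) + 2 * (2 * a * e)"
    by (intro add_mono sum_mono divide_right_mono U mult_left_mono atypical) auto
  also have "(\<Sum>l=1..a. ?U / real l + ?U / real l) = 2 * harm a * ?U"
    by (simp add: harm_def sum_distrib_left sum_distrib_right field_simps)
  finally show ?thesis by simp
qed

subsection \<open>Nonadaptive policies\<close>

lemma sum_over_tests:
  fixes F :: "real \<Rightarrow> real"
  shows "(\<Sum>y\<in>Ones \<union> Zeros. F (c y)) = 2 * (\<Sum>l=1..a. F (unit_cost l))"
proof -
  have "(\<Sum>y\<in>Ones. F (c y)) = (\<Sum>l=1..a. F (unit_cost l))"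
    unfolding Ones_def by (intro sum.cong) (auto simp: c_def)
  moreover have "(\<Sum>y\<in>Zeros. F (c y)) = (\<Sum>l=1..a. F (unit_cost l))"
    unfolding Zeros_def
    by (rule sum.reindex_bij_witness[of _ "\<lambda>i. a + i" "\<lambda>i. i - a"]) (auto simp: c_def)
  ultimately show ?thesis
    using parts(2) by (simp add: sum.union_disjoint)
qed

text \<open>By symmetry and unimodality, the binomial coefficient is smallest at
  \<open>M - a\<close> on this window.\<close>

lemma heads_probability_ge:
  assumes "M - a \<le> t" "t < M + a"
  shows "real (2 * M choose (M - a)) / 4 ^ M - 2 * a * e \<le> E (\<lambda>x. of_bool (typical x \<and> heads x = t))"
proof -
  have "2 * M choose (M - a) \<le> 2 * M choose t"
  proof (cases "t \<le> M")
    case True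
    with assms show ?thesis by (intro binomial_mono) auto
  next
    case False
    have "2 * M choose (M - a) \<le> 2 * M choose (2 * M - t)"
      using False assms a by (intro binomial_mono) auto
    also have "\<dots> = 2 * M choose t"
      using assms a by (intro binomial_symmetric[symmetric]) auto
    finally show ?thesis .
  qed
  then have "real (2 * M choose (M - a)) / 4 ^ M \<le> real (2 * M choose t) / 4 ^ M"
    by (intro divide_right_mono) auto
  then have "real (2 * M choose (M - a)) / 4 ^ M - 2 * a * e \<le>
      E (\<lambda>x. of_bool (heads x = t)) - E (\<lambda>x. of_bool (\<not> typical x))"
    using atypical unfolding heads_distribution by linarith
  also have "\<dots> = E (\<lambda>x. of_bool (heads x = t) - of_bool (\<not> typical x))"
    by (rule Bochner_Integration.integral_diff[symmetric]) (rule integrable_input)+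
  also have "\<dots> \<le> E (\<lambda>x. of_bool (typical x \<and> heads x = t))"
    by (rule input_expectation_mono) auto
  finally show ?thesis .
qed

text \<open>
  For \<open>y\<close> at position \<open>j\<close> among the variables in \<open>Ones\<close>, an input with exactly \<open>j\<close> missing ones
  forces the policy to test \<open>y\<close> and everything before it; \<open>Zeros\<close> is analogous. Over all \<open>y\<close>,
  each pair of variables then contributes at least the smaller of its two costs.
\<close>

lemma nonadaptive_ge:
  assumes na: "is_nonadaptive n \<pi>" and pos: "2 * a * e \<le> real (2 * M choose (M - a)) / 4 ^ M"
  shows "(real (2 * M choose (M - a)) / 4 ^ M - 2 * a * e) * (4 * harm a - 6) \<le> expected_cost n f c p \<pi>"
proof -
  obtain \<sigma> where \<sigma>: "\<sigma> permutes {1..n}"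
    "\<And>s j. j < n \<Longrightarrow> dom s = \<sigma> ` {1..j} \<Longrightarrow> \<pi> s = \<sigma> (Suc j)"
    and pol: "is_policy n \<pi>"
    using na unfolding is_nonadaptive_def by blast
  define r where "r = inv \<sigma>"
  have tested: "y \<in> \<sigma> ` {1..m} \<longleftrightarrow> r y \<le> m" if "y \<in> {1..n}" for y m
  proof -
    have "r y \<in> {1..n}"
      unfolding r_def using that permutes_in_image[OF permutes_inv[OF \<sigma>(1)]] by blast
    moreover have "y \<in> \<sigma> ` {1..m} \<longleftrightarrow> r y \<in> {1..m}"
      unfolding r_def using permutes_bij[OF \<sigma>(1)] permutes_inverses[OF \<sigma>(1)]
      by (metis imageE image_eqI)
    ultimately show ?thesis by auto
  qed
  have inj_r: "r y = r z \<Longrightarrow> y = z" for y z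
    unfolding r_def using permutes_inverses(1)[OF \<sigma>(1)] by metis
  \<comment> \<open>For \<open>y\<close> in \<open>X\<close>, its position among \<open>X\<close> in
    testing order, counted from 1.\<close>
  define J where "J = (\<lambda>X y. card {z \<in> X. r z \<le> r y})"
  have J_less: "J X y < J X y'" if "finite X" "y' \<in> X" "r y < r y'" for X y y'
  proof -
    have "{z \<in> X. r z \<le> r y} \<subseteq> {z \<in> X. r z \<le> r y'}" using that by auto
    moreover have "y' \<in> {z \<in> X. r z \<le> r y'} - {z \<in> X. r z \<le> r y}" using that by auto
    ultimately show ?thesis unfolding J_def using that(1) by (intro psubset_card_mono) auto
  qed
  have J_inj: "y = y'" if "finite X" "y \<in> X" "y' \<in> X" "J X y = J X y'" for X y y'
    using J_less[of X y' y] J_less[of X y y'] that inj_r[of y y'] by (metis less_irrefl linorder_neqE_nat)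
  have J_bounds: "1 \<le> J X y" "J X y \<le> card X" if "finite X" "y \<in> X" for X y
  proof -
    have "card {z \<in> X. r z \<le> r y} > 0" using that by (auto simp: card_gt_0_iff)
    then show "1 \<le> J X y" by (simp add: J_def)
    show "J X y \<le> card X" unfolding J_def using that by (intro card_mono) auto
  qed
  have J_before: "card {z \<in> X. r z < r y} = J X y - 1" if "finite X" "y \<in> X" for X y
  proof -
    have "{z \<in> X. r z \<le> r y} = insert y {z \<in> X. r z < r y}"
      using that inj_r by (auto simp: le_less)
    then show ?thesis using that by (simp add: J_def)
  qed
  \<comment> \<open>With \<open>t y\<close> heads on a typical input, \<open>y\<close> itself
    completes the certificate: \<open>t y + J Ones y = M + a\<close> ones, or
    \<open>2 * M - t y + J Zeros y = M + a + 1\<close> zeros.\<close>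
  define t where "t = (\<lambda>y. if y \<in> Ones then M + a - J Ones y else M + J Zeros y - (a + 1))"
  have t_Ones: "t y = M + a - J Ones y" "M \<le> t y" "t y < M + a" "J Ones y \<le> a" if "y \<in> Ones" for y
    using J_bounds[of Ones y] that a by (auto simp: t_def)
  have t_Zeros: "t y = M + J Zeros y - (a + 1)" "M - a \<le> t y" "t y < M" "1 \<le> J Zeros y" if "y \<in> Zeros" for y
    using J_bounds[of Zeros y] that a parts(2) by (auto simp: t_def)
  \<comment> \<open>Values from \<open>M\<close> on belong to \<open>Ones\<close> and smaller ones
    to \<open>Zeros\<close>. Injectivity makes the events for different \<open>y\<close> disjoint,
    so their costs can be added up.\<close>
  have t_inj: "y = y'" if yy: "y \<in> Ones \<union> Zeros" "y' \<in> Ones \<union> Zeros" "t y = t y'" for y y'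
  proof -
    have "z \<in> Ones \<longleftrightarrow> M \<le> t z" if "z \<in> Ones \<union> Zeros" for z
      using that t_Ones(2)[of z] t_Zeros(3)[of z] by (cases "z \<in> Ones") auto
    then consider "y \<in> Ones" "y' \<in> Ones" | "y \<in> Zeros" "y' \<in> Zeros"
      using yy by (metis UnE)
    then show ?thesis
    proof cases
      case 1
      then have "J Ones y = J Ones y'" using t_Ones[of y] t_Ones[of y'] yy(3) by linarith
      then show ?thesis using J_inj[of Ones] 1 by simp
    next
      case 2
      then have "J Zeros y = J Zeros y'" using t_Zeros[of y] t_Zeros[of y'] yy(3) a by linarith
      then show ?thesis using J_inj[of Zeros] 2 by simp
    qed
  qed
  define D where "D = (\<lambda>y. sum c {z \<in> Ones \<union> Zeros. r z \<le> r y})"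
  have D_nonneg: "0 \<le> D y" for y unfolding D_def by (intro sum_nonneg) simp
  have D_le_cost: "D y \<le> cost n f c \<pi> x"
    if y: "y \<in> Ones \<union> Zeros" and x: "typical x" "heads x = t y" for x y
  proof -
    obtain m where m: "m \<le> n" "final_state n f \<pi> x = observed x (\<sigma> ` {1..m})"
      "determined n f (observed x (\<sigma> ` {1..m}))"
      using nonadaptive_final_state[OF pol \<sigma>, of f x] by blast
    let ?S = "\<sigma> ` {1..m}"
    have S: "?S \<subseteq> {1..n}" using m(1) permutes_image[OF \<sigma>(1)] by auto
    have "r y \<le> m"
    proof (rule ccontr)
      assume *: "\<not> r y \<le> m"
      have before: "z \<in> {z. r z < r y}" if "z \<in> ?S" for z
        using tested[of z m] S that * by fastforce
      obtain b where b: "quota n k b \<le> card {i \<in> ?S. x i = b}"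
        using m(3) unfolding determined_observed[OF kn S] by blast
      have "{i \<in> ?S. x i = True} \<subseteq> {i \<in> Coins. x i} \<union> {z \<in> Ones. r z < r y}"
        "{i \<in> ?S. x i = False} \<subseteq> {i \<in> Coins. \<not> x i} \<union> {z \<in> Zeros. r z < r y}"
        using S before x(1) parts(1) by (auto simp: typical_def)
      then have un: "card {i \<in> ?S. x i = True} \<le> card ({i \<in> Coins. x i} \<union> {z \<in> Ones. r z < r y})"
        "card {i \<in> ?S. x i = False} \<le> card ({i \<in> Coins. \<not> x i} \<union> {z \<in> Zeros. r z < r y})"
        by (intro card_mono; simp)+
      have count: "card {i \<in> ?S. x i = True} \<le> heads x + card {z \<in> Ones. r z < r y}"
        "card {i \<in> ?S. x i = False} \<le> 2 * M - heads x + card {z \<in> Zeros. r z < r y}"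
        using order.trans[OF un(1) card_Un_le] order.trans[OF un(2) card_Un_le]
        unfolding tails(1) heads_def[symmetric] .
      have le_a: "card {z \<in> Ones. r z < r y} \<le> a" "card {z \<in> Zeros. r z < r y} \<le> a"
        using card_mono[of Ones "{z \<in> Ones. r z < r y}"] card_mono[of Zeros "{z \<in> Zeros. r z < r y}"] by auto
      \<comment> \<open>Without \<open>y\<close>, its own value is at least one short of its quota;
        the other value misses its quota even with its whole block.\<close>
      have "card {i \<in> ?S. x i = True} < M + a \<and> card {i \<in> ?S. x i = False} < M + a + 1"
      proof (cases "y \<in> Ones")
        case True
        then show ?thesis
          using count le_a x(2) t_Ones[OF True] J_before[of Ones y] J_bounds[of Ones y]
          unfolding parts_card by simp linarith
      next
        case False
        with y have "y \<in> Zeros" by blast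
        then show ?thesis
          using count le_a x(2) t_Zeros[of y] J_before[of Zeros y] J_bounds[of Zeros y] a
          unfolding parts_card by simp
      qed
      with b show False by (cases b) (auto simp: quota)
    qed
    have "{z \<in> Ones \<union> Zeros. r z \<le> r y} \<subseteq> ?S"
    proof
      fix z assume z: "z \<in> {z \<in> Ones \<union> Zeros. r z \<le> r y}"
      then have "z \<in> {1..n}" unfolding parts(1) by blast
      moreover have "r z \<le> m" using z \<open>r y \<le> m\<close> by simp
      ultimately show "z \<in> ?S" using tested by blast
    qed
    then show ?thesis
      unfolding D_def cost_def m(2) dom_observed by (intro sum_mono2) auto
  qed
  have pointwise: "(\<Sum>y\<in>Ones \<union> Zeros. of_bool (typical x \<and> heads x = t y) * D y) \<le> cost n f c \<pi> x" for x
  proof (cases "\<exists>y\<in>Ones \<union> Zeros. typical x \<and> heads x = t y")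
    case True
    then obtain y where y: "y \<in> Ones \<union> Zeros" "typical x" "heads x = t y" by blast
    have "(\<Sum>z\<in>Ones \<union> Zeros. of_bool (typical x \<and> heads x = t z) * D z) =
        (\<Sum>z\<in>Ones \<union> Zeros. if z = y then D z else 0)"
      using y t_inj by (intro sum.cong) auto
    also have "\<dots> = D y" using y(1) by (simp add: sum.delta)
    also have "\<dots> \<le> cost n f c \<pi> x" using D_le_cost y by blast
    finally show ?thesis .
  next
    case False
    then have "(\<Sum>y\<in>Ones \<union> Zeros. of_bool (typical x \<and> heads x = t y) * D y) = 0"
      by (intro sum.neutral) auto
    then show ?thesis using cost_bounds(1)[OF pol, of c f x] by simp
  qed
  have D_sum: "4 * harm a - 6 \<le> sum D (Ones \<union> Zeros)"
  proof -
    let ?T = "Ones \<union> Zeros" and ?g = "\<lambda>y z. if r z \<le> r y then c z else 0"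
    have D: "D y = (\<Sum>z\<in>?T. ?g y z)" for y
      unfolding D_def by (intro sum.inter_filter) simp
    \<comment> \<open>Each unit cost occurs in both \<open>Ones\<close> and \<open>Zeros\<close>, so
      a double sum over pairs gains the factor 4.\<close>
    have "2 * (4 * harm a - 6) \<le> 4 * (\<Sum>i=1..a. \<Sum>j=1..a. min (unit_cost i) (unit_cost j))"
      using sum_min_unit_cost[of a] by simp
    also have "\<dots> = (\<Sum>y\<in>?T. \<Sum>z\<in>?T. min (c y) (c z))"
      unfolding sum_over_tests[of "min _"]
      by (subst sum_over_tests[of "\<lambda>v. 2 * (\<Sum>l=1..a. min v (unit_cost l))"]) (simp add: sum_distrib_left)
    \<comment> \<open>Of two variables, the one tested earlier is counted in \<open>D\<close> of the
      other.\<close>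
    also have "\<dots> \<le> (\<Sum>y\<in>?T. \<Sum>z\<in>?T. ?g y z + ?g z y)"
      by (intro sum_mono) (auto simp: min_def)
    also have "\<dots> = (\<Sum>y\<in>?T. \<Sum>z\<in>?T. ?g y z) + (\<Sum>y\<in>?T. \<Sum>z\<in>?T. ?g z y)"
      by (simp add: sum.distrib)
    also have "(\<Sum>y\<in>?T. \<Sum>z\<in>?T. ?g z y) = (\<Sum>y\<in>?T. \<Sum>z\<in>?T. ?g y z)"
      by (rule sum.swap)
    also have "(\<Sum>y\<in>?T. \<Sum>z\<in>?T. ?g y z) = sum D ?T"
      by (rule sum.cong[OF refl D[symmetric]])
    finally show ?thesis by simp
  qed
  let ?u = "real (2 * M choose (M - a)) / 4 ^ M - 2 * a * e"
  have "?u * (4 * harm a - 6) \<le> ?u * sum D (Ones \<union> Zeros)"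
    using pos D_sum by (intro mult_left_mono) auto
  also have "\<dots> = (\<Sum>y\<in>Ones \<union> Zeros. ?u * D y)" by (rule sum_distrib_left)
  also have "\<dots> \<le> (\<Sum>y\<in>Ones \<union> Zeros. E (\<lambda>x. of_bool (typical x \<and> heads x = t y)) * D y)"
  proof (intro sum_mono mult_right_mono D_nonneg heads_probability_ge)
    fix y assume "y \<in> Ones \<union> Zeros"
    then show "M - a \<le> t y" "t y < M + a"
      using t_Ones(2,3)[of y] t_Zeros(2,3)[of y] by auto
  qed
  also have "\<dots> = E (\<lambda>x. \<Sum>y\<in>Ones \<union> Zeros. of_bool (typical x \<and> heads x = t y) * D y)"
    by (simp only: Bochner_Integration.integral_sum integrable_input integral_mult_left_zero)
  also have "\<dots> \<le> E (cost n f c \<pi>)"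
    by (rule input_expectation_mono) (rule pointwise)
  finally show ?thesis by (simp add: expected_cost_def)
qed

end

section \<open>The adaptivity gap is at least 2\<close>

text \<open>Neighbouring coefficients have ratio \<open>(M - a) / (M + a + 1)\<close>, which tends
  to 1. This makes the coins almost uniform on a window of fixed width.\<close>

lemma central_binomial_ratio:
  "(\<lambda>M. real (2 * M choose (M - a)) / real (2 * M choose M)) \<longlonglongrightarrow> 1"
proof (induction a)
  case 0
  show ?case by (simp add: zero_less_binomial_iff)
next
  case (Suc a)
  have step: "real (2 * M choose (M - a)) / real (2 * M choose M) * (real (M - a) / real (M + a + 1)) =
      real (2 * M choose (M - Suc a)) / real (2 * M choose M)" if "M \<ge> Suc a" for M
  proof -
    have "Suc (M - Suc a) = M - a" "2 * M - (M - Suc a) = M + a + 1" using that by simp_all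
    then have "(M - a) * (2 * M choose (M - a)) = (M + a + 1) * (2 * M choose (M - Suc a))"
      using binomial_absorb_comp[of "2 * M" "M - Suc a"] binomial_absorption[of "M - Suc a" "2 * M"]
      by metis
    then have "real (M - a) * real (2 * M choose (M - a)) = real (M + a + 1) * real (2 * M choose (M - Suc a))"
      by (metis of_nat_mult)
    then show ?thesis by (simp add: divide_simps mult.commute)
  qed
  have "(\<lambda>M. real (M - a) / real (M + a + 1)) \<longlonglongrightarrow> 1"
  proof (rule Lim_transform_eventually)
    show "(\<lambda>M. (real M - real a) / (real M + real a + 1)) \<longlonglongrightarrow> 1" by real_asymp
    show "\<forall>\<^sub>F M in sequentially. (real M - real a) / (real M + real a + 1) = real (M - a) / real (M + a + 1)"
      using eventually_ge_at_top[of a] by eventually_elim (simp add: of_nat_diff)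
  qed
  from tendsto_mult[OF Suc this]
  have lim: "(\<lambda>M. real (2 * M choose (M - a)) / real (2 * M choose M) * (real (M - a) / real (M + a + 1)))
      \<longlonglongrightarrow> 1"
    by (simp only: mult_1)
  show ?case
    by (rule Lim_transform_eventually[OF lim], rule eventually_mono[OF eventually_ge_at_top step])
qed

text \<open>First \<open>M\<close> is taken large enough to flatten the window up to a fraction
  \<open>d\<close>; then \<open>e\<close> is chosen, depending on \<open>M\<close> through
  \<open>U\<close>, so that atypical inputs lose at most another fraction \<open>d\<close>. The
  common factor \<open>U\<close> cancels in the quotient.\<close>

lemma gap_lower_bound:
  assumes a: "3 \<le> a" and H: "2 \<le> (harm a :: real)"
  obtains n f c p where "(n, f, c, p) \<in> instances" "0 < expected_cost n f c p (OPT n f c p)"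
    "(1 - 2 / real a) * (4 * harm a - 6) / (2 * harm a + 2 / real a) \<le>
       expected_cost n f c p (OPT_NA n f c p) / expected_cost n f c p (OPT n f c p)"
proof -
  define d where "d = 1 / real a"
  have d: "0 < d" "2 * d < 1" using a by (auto simp: d_def field_simps)
  have "\<forall>\<^sub>F M in sequentially. a \<le> M \<and> 1 - d < real (2 * M choose (M - a)) / real (2 * M choose M)"
    using d(1) by (intro eventually_conj eventually_ge_at_top order_tendstoD(1)[OF central_binomial_ratio]) simp
  then obtain M where M: "a \<le> M" "1 - d < real (2 * M choose (M - a)) / real (2 * M choose M)"
    by (auto simp: eventually_sequentially)
  define U where "U = real (2 * M choose M) / 4 ^ M"
  have U: "0 < U" by (simp add: U_def zero_less_binomial_iff)
  define u where "u = real (2 * M choose (M - a)) / 4 ^ M"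
  have u: "(1 - d) * U \<le> u"
    unfolding u_def U_def times_divide_eq_right using M(2)
    by (intro divide_right_mono) (simp_all add: pos_less_divide_eq less_imp_le zero_less_binomial_iff)
  define e where "e = min (1 / 2) (d * U / (2 * real a))"
  have small: "0 < e" "e < 1" "2 * real a * e \<le> d * U"
    using a d U by (auto simp: e_def min_def field_simps)
  interpret gap_instance a M e
    using a M small by unfold_locales auto
  let ?O = "expected_cost n f c p (OPT n f c p)" and ?N = "expected_cost n f c p (OPT_NA n f c p)"
  have "(1 - 2 * d) * U \<le> u - 2 * a * e" using u small(3) by (simp add: algebra_simps)
  moreover have "0 < (1 - 2 * d) * U" using d U by simp
  ultimately have N: "(1 - 2 * d) * U * (4 * harm a - 6) \<le> ?N"
    using nonadaptive_ge[OF OPT_properties(3), of f c p] H unfolding u_def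
    by (smt (verit) mult_right_mono)
  have NO: "?N \<le> 2 * ?O"
    by (intro nonadaptive_2_approx kn conjI p_bounds c_nonneg)
  have O: "?O \<le> (2 * harm a + 2 * d) * U"
    using OPT_le small(3) unfolding U_def[symmetric] by (simp add: algebra_simps)
  have num: "0 < (1 - 2 * d) * U * (4 * harm a - 6)" using d U H by simp
  \<comment> \<open>Positivity of the optimum comes from the upper bound: the nonadaptive cost is
    positive and at most twice as large.\<close>
  with N NO have pos: "0 < ?O" by linarith
  have "(1 - 2 * d) * (4 * harm a - 6) / (2 * harm a + 2 * d) =
      (1 - 2 * d) * U * (4 * harm a - 6) / ((2 * harm a + 2 * d) * U)"
    using U by simp
  also have "\<dots> \<le> ?N / ?O"
    using N O num pos by (intro frac_le) auto
  finally show thesis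
    using that[OF instance_mem pos] by (simp add: d_def)
qed

text \<open>Divide numerator and denominator by \<open>harm a\<close>, which tends to
  infinity.\<close>

lemma gap_bound_limit:
  "(\<lambda>a. (1 - 2 / real a) * (4 * harm a - 6) / (2 * harm a + 2 / real a)) \<longlonglongrightarrow> 2"
proof -
  let ?i = "\<lambda>a. inverse (harm a :: real)"
  have "filterlim (\<lambda>a. ln (real a + 1)) at_top sequentially" by real_asymp
  then have top: "filterlim (\<lambda>a. harm a :: real) at_top sequentially"
    by (rule filterlim_at_top_mono) (auto intro!: always_eventually ln_le_harm)
  then have i: "?i \<longlonglongrightarrow> 0" by (rule tendsto_inverse_0_at_top)
  have v: "(\<lambda>a. 2 / real a) \<longlonglongrightarrow> 0" by real_asymp
  have "(\<lambda>a. (1 - 2 / real a) * (4 - 6 * ?i a) / (2 + 2 / real a * ?i a)) \<longlonglongrightarrow> (1 - 0) * (4 - 6 * 0) / (2 + 0 * 0)"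
    by (intro tendsto_intros i v) simp
  then have lim: "(\<lambda>a. (1 - 2 / real a) * (4 - 6 * ?i a) / (2 + 2 / real a * ?i a)) \<longlonglongrightarrow> 2"
    by simp
  show ?thesis
  proof (rule Lim_transform_eventually[OF lim])
    have "\<forall>\<^sub>F a in sequentially. 0 < (harm a :: real)"
      using top by (auto simp: filterlim_at_top_dense)
    then show "\<forall>\<^sub>F a in sequentially. (1 - 2 / real a) * (4 - 6 * ?i a) / (2 + 2 / real a * ?i a) =
        (1 - 2 / real a) * (4 * harm a - 6) / (2 * harm a + 2 / real a)"
    proof eventually_elim
      case (elim a)
      then have H: "harm a * ?i a = 1" by (intro right_inverse less_imp_neq[THEN not_sym])
      have "4 - 6 * ?i a = (4 * harm a - 6) * ?i a" "2 + 2 / real a * ?i a = (2 * harm a + 2 / real a) * ?i a"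
        using H by (simp_all add: left_diff_distrib distrib_right mult.assoc)
      moreover have "?i a \<noteq> 0" using H by auto
      ultimately show ?case by (simp add: mult.assoc[symmetric])
    qed
  qed
qed

theorem theorem1:
  "(SUP (n, f, c, p) \<in> {(n, f, c, p) \<in> instances. expected_cost n f c p (OPT n f c p) > 0}.
      ereal (expected_cost n f c p (OPT_NA n f c p) / expected_cost n f c p (OPT n f c p))) = 2"
proof (rule antisym)
  show "(SUP (n, f, c, p) \<in> {(n, f, c, p) \<in> instances. expected_cost n f c p (OPT n f c p) > 0}.
      ereal (expected_cost n f c p (OPT_NA n f c p) / expected_cost n f c p (OPT n f c p))) \<le> 2"
  proof (rule SUP_least, clarify)
    fix n f c p
    assume "(n, f, c, p) \<in> instances" and pos: "0 < expected_cost n f c p (OPT n f c p)"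
    then obtain k where "k \<in> {1..n}" "f = k_of_n k n" "\<forall>i\<in>{1..n}. 0 \<le> c i"
      "\<forall>i\<in>{1..n}. 0 < p i \<and> p i < 1"
      by (auto simp: instances_def)
    then have "expected_cost n f c p (OPT_NA n f c p) \<le> 2 * expected_cost n f c p (OPT n f c p)"
      using nonadaptive_2_approx[of k n p c] by simp
    with pos have "expected_cost n f c p (OPT_NA n f c p) / expected_cost n f c p (OPT n f c p) \<le> 2"
      by (simp add: divide_le_eq)
    then show "ereal (expected_cost n f c p (OPT_NA n f c p) / expected_cost n f c p (OPT n f c p)) \<le> 2"
      by simp
  qed
  show "2 \<le> (SUP (n, f, c, p) \<in> {(n, f, c, p) \<in> instances. expected_cost n f c p (OPT n f c p) > 0}.
      ereal (expected_cost n f c p (OPT_NA n f c p) / expected_cost n f c p (OPT n f c p)))"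
    unfolding le_SUP_iff
  proof (intro allI impI)
    fix y :: ereal assume y: "y < 2"
    let ?g = "\<lambda>a. (1 - 2 / real a) * (4 * harm a - 6) / (2 * harm a + 2 / real a)"
    have "(\<lambda>a. ereal (?g a)) \<longlonglongrightarrow> ereal 2" using gap_bound_limit by simp
    then have "\<forall>\<^sub>F a in sequentially. y < ereal (?g a)" using y by (intro order_tendstoD(1)) simp_all
    moreover have "\<forall>\<^sub>F a in sequentially. 2 \<le> (harm a :: real)"
    proof -
      have "\<forall>\<^sub>F a in sequentially. 2 \<le> ln (real a + 1)" by real_asymp
      then show ?thesis by eventually_elim (use ln_le_harm order.trans in blast)
    qed
    ultimately have "\<forall>\<^sub>F a in sequentially. y < ereal (?g a) \<and> 2 \<le> (harm a :: real) \<and> 3 \<le> a"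
      using eventually_ge_at_top[of 3] by eventually_elim auto
    then obtain a where a: "y < ereal (?g a)" "2 \<le> (harm a :: real)" "3 \<le> a"
      by (auto simp: eventually_sequentially)
    obtain n f c p where inst: "(n, f, c, p) \<in> instances" "0 < expected_cost n f c p (OPT n f c p)"
      "?g a \<le> expected_cost n f c p (OPT_NA n f c p) / expected_cost n f c p (OPT n f c p)"
      by (rule gap_lower_bound[OF a(3,2)])
    have "y < ereal (expected_cost n f c p (OPT_NA n f c p) / expected_cost n f c p (OPT n f c p))"
      using a(1) inst(3) by (meson ereal_less_eq(3) less_le_trans)
    with inst(1,2) show "\<exists>i\<in>{(n, f, c, p) \<in> instances. expected_cost n f c p (OPT n f c p) > 0}. y <
      (case i of (n, f, c, p) \<Rightarrow>
        ereal (expected_cost n f c p (OPT_NA n f c p) / expected_cost n f c p (OPT n f c p)))"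
      by (intro bexI[of _ "(n, f, c, p)"]) auto
  qed
qed

end
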